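(* Let $n,d$ be positive integers, $S=\mathbb{C}[x_0,\ldots,x_n]$, let $I\subset S$ be the ideal generated by the $2^n$ forms $(x_0\pm x_1\pm\cdots\pm x_n)^d$, and let $R=S/I$. The Hilbert function $\mathrm{HF}(R;i)=\dim_{\mathbb{C}}R_i$ is given by: (1) if $i<d$, then $\mathrm{HF}(R;i)=\binom{n+i}{n}$; (2) if $i=j+d$ with $j\ge 0$, then $$\mathrm{HF}(R;i)=\sum_{\mathbf{h}\in\mathcal{H}_j}\dim_{\mathbb{C}}R_{i,\mathbf{h}}=\sum_{\substack{0\le h<d-j\\ i-h\in 2\mathbb{N}}}\binom{n+1}{h}\left(\binom{n+\frac{i-h}{2}}{n}-\binom{n+j}{n}\right).$$
   Context: $\mathbb{N}$ includes $0$. Elements of $\mathbb{Z}_2=\mathbb{Z}/2\mathbb{Z}$ are identified with $0,1$. For $\mathbf{h}=(h_0,\ldots,h_n)\in\mathbb{Z}_2^{n+1}$, the weight is $\mathrm{wt}(\mathbf{h})=\sum_j h_j\in\mathbb{N}$. $S_{i,\mathbf{h}}$ is the span of the monomials $x_0^{a_0}\cdots x_n^{a_n}$ of degree $i$ with $a_j\equiv h_j \pmod 2$ for all $j$; this makes $S$ graded by $\mathbb{N}\times\mathbb{Z}_2^{n+1}$, the ideal $I$ is homogeneous for this grading, and $R_{i,\mathbf{h}}$ denotes the corresponding component of $R=S/I$. For $i=j+d$, $\mathcal{H}_j:=\{\mathbf{h}\in\mathbb{Z}_2^{n+1} : i-\mathrm{wt}(\mathbf{h})\in 2\mathbb{N},\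 \mathrm{wt}(\mathbf{h})<d-j,\ \mathrm{wt}(\mathbf{h})\le n+1\}$. *)

theory Defs
  imports
    Complex_Main
    "HOL-Library.Poly_Mapping"
    "HOL-Library.FuncSet"
    "HOL-Library.Z2"
    "HOL-Algebra.QuotRing"
    "HOL-Algebra.Embedded_Algebras"
begin

text \<open>
  A monomial is its exponent vector, a finitely supported map from variable indices to \<open>nat\<close>,
  and a polynomial is the finitely supported map of its coefficients. On the latter,
  multiplication in \<open>HOL-Library.Poly_Mapping\<close> is convolution, i.e. polynomial multiplication.
\<close>

type_synonym monom = "nat \<Rightarrow>\<^sub>0 nat"
type_synonym cpoly = "monom \<Rightarrow>\<^sub>0 complex"

definition var :: "nat \<Rightarrow> cpoly"
  where "var k = Poly_Mapping.single (Poly_Mapping.single k 1) 1"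

definition const :: "complex \<Rightarrow> cpoly"
  where "const c = Poly_Mapping.single 0 c"

text \<open>The ring \<open>S = \<complex>[x\<^sub>0, \<dots>, x\<^sub>n]\<close>.\<close>

definition S_ring :: "nat \<Rightarrow> cpoly ring"
  where "S_ring n =
    \<lparr>carrier = {p. \<forall>m \<in> Poly_Mapping.keys p. Poly_Mapping.keys m \<subseteq> {..n}},
     mult = (*), one = 1, zero = 0, add = (+)\<rparr>"

definition mdeg :: "nat \<Rightarrow> monom \<Rightarrow> nat"
  where "mdeg n m = (\<Sum>k\<le>n. Poly_Mapping.lookup m k)"

text \<open>
  The elements of \<open>\<int>\<^sub>2\<^sup>n\<^sup>+\<^sup>1\<close> are the extensional functions from \<open>{..n}\<close> to \<open>bit\<close>; the
  coordinates are identified with the naturals 0 and 1 by \<open>of_bit\<close>.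
\<close>

definition Z2_vecs :: "nat \<Rightarrow> (nat \<Rightarrow> bit) set"
  where "Z2_vecs n = {..n} \<rightarrow>\<^sub>E (UNIV :: bit set)"

definition wt :: "nat \<Rightarrow> (nat \<Rightarrow> bit) \<Rightarrow> nat"
  where "wt n h = (\<Sum>k\<le>n. of_bit (h k))"

text \<open>
  The spans of the monomials of degree \<open>i\<close>, and of those whose exponents are moreover congruent
  to \<open>h\<close> modulo 2: a polynomial lies in the span of a set of monomials iff all monomials
  occurring in it belong to that set.
\<close>

definition S_deg :: "nat \<Rightarrow> nat \<Rightarrow> cpoly set"
  where "S_deg n i =
    {p \<in> carrier (S_ring n). \<forall>m \<in> Poly_Mapping.keys p. mdeg n m = i}"

definition S_bideg :: "nat \<Rightarrow> nat \<Rightarrow> (nat \<Rightarrow> bit) \<Rightarrow> cpoly set"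
  where "S_bideg n i h =
    {p \<in> carrier (S_ring n). \<forall>m \<in> Poly_Mapping.keys p.
       mdeg n m = i \<and> (\<forall>k\<le>n. of_nat (Poly_Mapping.lookup m k) = h k)}"

definition power_forms :: "nat \<Rightarrow> nat \<Rightarrow> cpoly set"
  where "power_forms n d =
    {(var 0 + (\<Sum>k = 1..n. const (\<epsilon> k) * var k)) ^ d | \<epsilon>. \<forall>k\<in>{1..n}. \<epsilon> k \<in> {1, - 1}}"

definition I_ideal :: "nat \<Rightarrow> nat \<Rightarrow> cpoly set"
  where "I_ideal n d = genideal (S_ring n) (power_forms n d)"

definition R_ring :: "nat \<Rightarrow> nat \<Rightarrow> cpoly set ring"
  where "R_ring n d = S_ring n Quot I_ideal n d"

definition residue_class :: "nat \<Rightarrow> nat \<Rightarrow> cpoly \<Rightarrow> cpoly set"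
  where "residue_class n d p = I_ideal n d +>\<^bsub>S_ring n\<^esub> p"

text \<open>
  Complex dimension of a subspace of \<open>R\<close>: \<open>\<complex>\<close> acts on \<open>R\<close> through the subfield formed by the
  residue classes of the constants, and \<open>ring.dim\<close> is the dimension over a subfield.
\<close>

definition R_dim :: "nat \<Rightarrow> nat \<Rightarrow> cpoly set set \<Rightarrow> nat"
  where "R_dim n d V = ring.dim (R_ring n d) (residue_class n d ` range const) V"

text \<open>The graded components of \<open>R\<close> are the images of those of \<open>S\<close>.\<close>

definition R_deg :: "nat \<Rightarrow> nat \<Rightarrow> nat \<Rightarrow> cpoly set set"
  where "R_deg n d i = residue_class n d ` S_deg n i"

definition R_bideg :: "nat \<Rightarrow> nat \<Rightarrow> nat \<Rightarrow> (nat \<Rightarrow> bit) \<Rightarrow> cpoly set set"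
  where "R_bideg n d i h = residue_class n d ` S_bideg n i h"

definition HF :: "nat \<Rightarrow> nat \<Rightarrow> nat \<Rightarrow> nat"
  where "HF n d i = R_dim n d (R_deg n d i)"

text \<open>The index set \<open>\<H>\<^sub>j\<close>, with \<open>i = j + d\<close>; \<open>d - j\<close> may be negative, hence the integers.\<close>

definition H_set :: "nat \<Rightarrow> nat \<Rightarrow> nat \<Rightarrow> (nat \<Rightarrow> bit) set"
  where "H_set n d j =
    {h \<in> Z2_vecs n. wt n h \<le> j + d \<and> even (j + d - wt n h) \<and>
       int (wt n h) < int d - int j \<and> wt n h \<le> n + 1}"

end

theory Submission
  imports Defs
begin

text \<open>
  Write \<open>\<ell>\<^sub>\<epsilon>\<close> for the linear form with signs \<open>\<epsilon>\<close>, where \<open>\<epsilon>\<^sub>0 = 1\<close>, and let \<open>i = j + d\<close>. A form of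
  degree \<open>i\<close> is encoded by the function \<open>q\<close> that takes an exponent vector \<open>b\<close> to \<open>b!\<close> times the
  coefficient of \<open>x\<^sup>b\<close>. By the multinomial theorem the product \<open>x\<^sup>a \<ell>\<^sub>\<epsilon>\<^sup>d\<close> with \<open>|a| = j\<close> is
  encoded by a constant times \<open>\<epsilon>\<^sup>b\<close> times a product of falling factorials of \<open>b\<^sub>0, \<dots>, b\<^sub>n\<close>, a polynomial of
  degree \<open>j\<close> in \<open>b\<close>. The factor \<open>\<epsilon>\<^sup>b\<close> depends only on the parities of \<open>b\<close>, and averaging over \<open>\<epsilon>\<close>
  separates the parity vectors. Hence a form supported on the monomials of one parity vector \<open>h\<close>
  lies in \<open>I\<close> if and only if its encoding is the restriction of a polynomial of degree at most \<open>j\<close>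
  in \<open>b\<close>; polynomials of lower degree are obtained from \<open>x\<^sup>a \<ell>\<^sub>\<epsilon>\<^sup>N\<close> with \<open>N = i - |a| > d\<close>.
  
  For fixed \<open>h\<close> write \<open>b = h + 2 c\<close>. The vectors \<open>c\<close> fill the simplex \<open>|c| = e\<close> with
  \<open>e = (i - wt h) / 2\<close>, on which \<open>c\<^sub>1, \<dots>, c\<^sub>n\<close> are coordinates. Newton interpolation on the simplex
  gives a basis of all functions on it, the products of binomial coefficients
  \<open>binomial(c\<^sub>k, \<alpha>\<^sub>k)\<close> with \<open>\<alpha>\<^sub>1 + \<dots> + \<alpha>\<^sub>n \<le> e\<close>, whose dual basis consists of iterated differences
  at the origin. Those of degree at most \<open>j\<close> span the polynomials of degree at most \<open>j\<close>, so those
  of degree above \<open>j\<close> give a basis of \<open>R\<close> in bidegree \<open>(i, h)\<close>. There are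
  \<open>binomial(n + e, n) - binomial(n + j, n)\<close> of them if \<open>j \<le> e\<close>, and none otherwise; and \<open>j < e\<close>
  means that \<open>wt h < d - j\<close>. Summing over \<open>h\<close> gives the Hilbert function.
  
  The two halves of the description of \<open>I\<close> are \<open>newton_poly_in_I\<close> and \<open>newton_coeff_vanishes_on_I\<close>,
  interpolation is \<open>newton_orthogonal\<close> and \<open>newton_inversion\<close>, and \<open>R_dim_eq_card\<close> turns a dual pair
  of bases into a dimension.
\<close>

section \<open>The polynomial ring and the ideal\<close>

lemma carrier_S [simp]: "p \<in> carrier (S_ring n) \<longleftrightarrow> (\<forall>m\<in>Poly_Mapping.keys p. Poly_Mapping.keys m \<subseteq> {..n})"
  by (simp add: S_ring_def)

lemma S_ring_ops [simp]:
  "mult (S_ring n) = (*)" "one (S_ring n) = 1" "zero (S_ring n) = 0" "add (S_ring n) = (+)"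
  by (simp_all add: S_ring_def)

lemma S_add_closed: "p \<in> carrier (S_ring n) \<Longrightarrow> q \<in> carrier (S_ring n) \<Longrightarrow> p + q \<in> carrier (S_ring n)"
  using keys_add[of p q] by auto

lemma keys_monom_add: "Poly_Mapping.keys (a + b) = Poly_Mapping.keys a \<union> Poly_Mapping.keys (b :: monom)"
  by (auto simp: in_keys_iff lookup_add)

lemma S_mult_closed: "p \<in> carrier (S_ring n) \<Longrightarrow> q \<in> carrier (S_ring n) \<Longrightarrow> p * q \<in> carrier (S_ring n)"
  using keys_mult[of p q] by (fastforce simp: keys_monom_add)

lemma S_uminus_closed: "p \<in> carrier (S_ring n) \<Longrightarrow> - p \<in> carrier (S_ring n)"
  by (auto simp: in_keys_iff)

lemma const_closed: "const c \<in> carrier (S_ring n)"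
  by (auto simp: const_def)

lemma one_closed_S: "1 \<in> carrier (S_ring n)"
  by auto

lemma var_closed: "k \<le> n \<Longrightarrow> var k \<in> carrier (S_ring n)"
  by (auto simp: var_def)

lemma sum_closed_S: "(\<And>x. x \<in> A \<Longrightarrow> f x \<in> carrier (S_ring n)) \<Longrightarrow> sum f A \<in> carrier (S_ring n)"
proof (induction A rule: infinite_finite_induct)
  case (insert x F)
  then show ?case by (simp del: carrier_S add: S_add_closed)
qed auto

lemma power_closed_S: "p \<in> carrier (S_ring n) \<Longrightarrow> p ^ N \<in> carrier (S_ring n)"
  by (induction N) (simp_all del: carrier_S add: S_mult_closed one_closed_S)

lemma cring_S: "cring (S_ring n)"
proof (rule cringI)
  show "abelian_group (S_ring n)"
  proof (rule abelian_groupI)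
    fix x assume "x \<in> carrier (S_ring n)"
    then show "\<exists>y\<in>carrier (S_ring n). y \<oplus>\<^bsub>S_ring n\<^esub> x = \<zero>\<^bsub>S_ring n\<^esub>"
      by (intro bexI[of _ "- x"] S_uminus_closed) simp_all
  qed (simp_all del: carrier_S add: S_add_closed add_ac, simp)
  show "Group.comm_monoid (S_ring n)"
    by (rule comm_monoidI) (simp_all del: carrier_S add: S_mult_closed one_closed_S mult_ac)
qed (simp add: distrib_right)

interpretation S: cring "S_ring n" for n
  by (rule cring_S)

lemma power_forms_closed: "power_forms n d \<subseteq> carrier (S_ring n)"
  unfolding power_forms_def
  by (auto simp del: carrier_S intro!: power_closed_S S_add_closed sum_closed_S S_mult_closed
      const_closed var_closed)

lemma ideal_I: "ideal (I_ideal n d) (S_ring n)"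
  unfolding I_ideal_def by (rule S.genideal_ideal[OF power_forms_closed])

lemma I_closed: "p \<in> I_ideal n d \<Longrightarrow> p \<in> carrier (S_ring n)"
  using additive_subgroup.a_subset[OF ideal.axioms(1)[OF ideal_I]] by blast

lemma I_zero: "0 \<in> I_ideal n d"
  using additive_subgroup.zero_closed[OF ideal.axioms(1)[OF ideal_I]] by simp

lemma I_add: "p \<in> I_ideal n d \<Longrightarrow> q \<in> I_ideal n d \<Longrightarrow> p + q \<in> I_ideal n d"
  using additive_subgroup.a_closed[OF ideal.axioms(1)[OF ideal_I]] by simp

lemma I_mult: "p \<in> I_ideal n d \<Longrightarrow> q \<in> carrier (S_ring n) \<Longrightarrow> q * p \<in> I_ideal n d"
  using ideal.I_l_closed[OF ideal_I] by simp

lemma I_sum: "(\<And>x. x \<in> A \<Longrightarrow> f x \<in> I_ideal n d) \<Longrightarrow> sum f A \<in> I_ideal n d"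
  by (induction A rule: infinite_finite_induct) (auto intro: I_zero I_add)

lemma I_generator: "p \<in> power_forms n d \<Longrightarrow> p \<in> I_ideal n d"
  unfolding I_ideal_def using S.genideal_self[OF power_forms_closed] by blast

lemma single_mult_lookup:
  "Poly_Mapping.lookup (Poly_Mapping.single a c * p) b =
     (if \<exists>m. b = a + m then c * Poly_Mapping.lookup p (b - a) else 0)" for p :: cpoly
proof -
  have "Poly_Mapping.lookup (Poly_Mapping.single a c * p) b =
      c * (\<Sum>q. (Poly_Mapping.lookup p q when b = a + q))"
    unfolding lookup_mult by (simp add: lookup_single when_mult Sum_any_when_equal)
  also have "(\<Sum>q. (Poly_Mapping.lookup p q when b = a + q)) =
      (if \<exists>m. b = a + m then Poly_Mapping.lookup p (b - a) else 0)"
  proof (cases "\<exists>m. b = a + m")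
    case True
    then have "(b = a + q) = (q = b - a)" for q by auto
    then show ?thesis using True by simp
  qed auto
  finally show ?thesis by auto
qed

lemma lookup_const_mult: "Poly_Mapping.lookup (const c * p) b = c * Poly_Mapping.lookup p b"
  unfolding const_def by (auto simp: single_mult_lookup)

lemma const_0: "const 0 = 0" and const_1: "const 1 = 1"
  and const_add: "const (a + b) = const a + const b"
  and const_mult: "const (a * b) = const a * const b"
  by (simp_all add: const_def single_add mult_single)

lemma poly_eq_sum_singles:
  "p = (\<Sum>a\<in>Poly_Mapping.keys p. Poly_Mapping.single a (Poly_Mapping.lookup p a))" for p :: cpoly
  by (rule poly_mapping_eqI) (auto simp: lookup_sum lookup_single when_def sum.delta in_keys_iff)

text \<open>
  The polynomials all of whose multiples are killed by \<open>f\<close> form an ideal, so additivity and the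
  vanishing on the multiples of the generators by single terms are enough.
\<close>

lemma functional_vanishes_on_I:
  fixes f :: "cpoly \<Rightarrow> complex"
  assumes add: "\<And>p q. f (p + q) = f p + f q"
    and gen: "\<And>a c g. Poly_Mapping.keys a \<subseteq> {..n} \<Longrightarrow> g \<in> power_forms n d \<Longrightarrow>
        f (Poly_Mapping.single a c * g) = 0"
    and p: "p \<in> I_ideal n d"
  shows "f p = 0"
proof -
  define J where "J = {p \<in> carrier (S_ring n). \<forall>q\<in>carrier (S_ring n). f (q * p) = 0}"
  have f0: "f 0 = 0" using add[of 0 0] by simp
  have fsum: "f (sum g A) = (\<Sum>x\<in>A. f (g x))" for g :: "monom \<Rightarrow> cpoly" and A
    by (induction A rule: infinite_finite_induct) (simp_all add: f0 add)
  have fneg: "f (- p) = - f p" for p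
    using add[of p "- p"] f0 by (simp add: eq_neg_iff_add_eq_0 add.commute)
  have "ideal J (S_ring n)"
  proof (rule idealI)
    show "ring (S_ring n)" by (rule S.ring_axioms)
    show "subgroup J (add_monoid (S_ring n))"
    proof (rule S.add.subgroupI)
      show "J \<noteq> {}" unfolding J_def using f0 by (auto intro!: exI[of _ 0])
      show "\<ominus>\<^bsub>S_ring n\<^esub> a \<in> J" if "a \<in> J" for a
      proof -
        have "\<ominus>\<^bsub>S_ring n\<^esub> a = - a"
          by (rule S.minus_equality)
            (use that in \<open>auto simp: J_def simp del: carrier_S intro: S_uminus_closed\<close>)
        then show ?thesis using that
          by (auto simp: J_def fneg simp del: carrier_S intro: S_uminus_closed)
      qed
    qed (auto simp: J_def distrib_left add simp del: carrier_S intro: S_add_closed)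
  next
    fix a x assume ax: "a \<in> J" "x \<in> carrier (S_ring n)"
    then have "f (q * (x * a)) = 0" if "q \<in> carrier (S_ring n)" for q
      using that S_mult_closed[of q n x] by (simp add: J_def mult.assoc del: carrier_S flip: mult.assoc)
    then show "x \<otimes>\<^bsub>S_ring n\<^esub> a \<in> J" "a \<otimes>\<^bsub>S_ring n\<^esub> x \<in> J"
      using ax S_mult_closed[of x n a] by (auto simp: J_def mult.commute simp del: carrier_S)
  qed
  moreover have "power_forms n d \<subseteq> J"
  proof
    fix g assume g: "g \<in> power_forms n d"
    have "f (q * g) = 0" if q: "q \<in> carrier (S_ring n)" for q
    proof -
      have "q * g = (\<Sum>a\<in>Poly_Mapping.keys q. Poly_Mapping.single a (Poly_Mapping.lookup q a) * g)"
        by (subst (1) poly_eq_sum_singles[of q]) (simp add: sum_distrib_right)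
      then show ?thesis using gen[OF _ g] q by (simp add: fsum)
    qed
    then show "g \<in> J" using g power_forms_closed by (auto simp: J_def simp del: carrier_S)
  qed
  ultimately have "I_ideal n d \<subseteq> J"
    unfolding I_ideal_def by (rule S.genideal_minimal)
  with p have "f (1 * p) = 0" unfolding J_def using one_closed_S by blast
  then show ?thesis by simp
qed

section \<open>Dimensions of subspaces of the quotient\<close>

lemma S_minus: "p \<in> carrier (S_ring n) \<Longrightarrow> q \<in> carrier (S_ring n) \<Longrightarrow> p \<ominus>\<^bsub>S_ring n\<^esub> q = p - q"
proof -
  assume p: "p \<in> carrier (S_ring n)" and q: "q \<in> carrier (S_ring n)"
  have "\<ominus>\<^bsub>S_ring n\<^esub> q = - q"
    by (rule S.minus_equality) (use q in \<open>auto simp del: carrier_S intro: S_uminus_closed\<close>)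
  then show ?thesis by (simp add: a_minus_def)
qed

text \<open>
  This is where \<open>d > 0\<close> is needed: without it \<open>R\<close> is the zero ring, and the residue classes of the
  constants do not form a field.
\<close>

lemma one_notin_I: "d > 0 \<Longrightarrow> 1 \<notin> I_ideal n d"
proof
  assume d: "d > 0" and "1 \<in> I_ideal n d"
  have "Poly_Mapping.lookup (1 :: cpoly) (0 :: monom) = 0"
  proof (rule functional_vanishes_on_I[OF _ _ \<open>1 \<in> I_ideal n d\<close>,
      where f = "\<lambda>p. Poly_Mapping.lookup p 0"])
    fix a :: monom and c g assume "g \<in> power_forms n d"
    then obtain \<epsilon> where g: "g = (var 0 + (\<Sum>k = 1..n. const (\<epsilon> k) * var k)) ^ d"
      unfolding power_forms_def by blast
    have no: "0 \<noteq> Poly_Mapping.single k (1 :: nat) + m" for k m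
    proof
      assume "0 = Poly_Mapping.single k (1 :: nat) + m"
      then have "Poly_Mapping.lookup 0 k = Poly_Mapping.lookup (Poly_Mapping.single k (1 :: nat) + m) k"
        by simp
      then show False by (simp add: lookup_add)
    qed
    have low: "Poly_Mapping.lookup (var k * q) 0 = 0" for k q
      using no[of k] by (auto simp: var_def single_mult_lookup)
    have "Poly_Mapping.lookup ((var 0 + (\<Sum>k = 1..n. const (\<epsilon> k) * var k)) * q) 0 = 0" for q
      by (simp add: distrib_right lookup_add sum_distrib_right lookup_sum mult.assoc
          lookup_const_mult low)
    then have "Poly_Mapping.lookup (g * q) 0 = 0" for q
      using d unfolding g by (cases d) (simp_all add: mult.assoc)
    then show "Poly_Mapping.lookup (Poly_Mapping.single a c * g) 0 = 0"
      by (metis mult.commute)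
  qed (simp add: lookup_add)
  then show False by (simp add: lookup_one)
qed

lemma subfield_const: "subfield (range const) (S_ring n)"
proof (rule S.subfieldI)
  show "subcring (range const) (S_ring n)"
  proof (rule S.subcringI', rule S.subringI)
    show "\<ominus>\<^bsub>S_ring n\<^esub> h \<in> range const" if "h \<in> range const" for h
    proof -
      from that obtain c where h: "h = const c" by blast
      have "\<ominus>\<^bsub>S_ring n\<^esub> h = const (- c)"
        by (rule S.minus_equality)
          (auto simp del: carrier_S simp: h const_closed const_0 simp flip: const_add)
      then show ?thesis by simp
    qed
  qed (auto simp del: carrier_S simp: const_closed simp flip: const_add const_mult const_1)
  show "Units (S_ring n\<lparr>carrier := range const\<rparr>) = range const - {\<zero>\<^bsub>S_ring n\<^esub>}"
  proof (intro equalityI subsetI)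
    fix x assume "x \<in> Units (S_ring n\<lparr>carrier := range const\<rparr>)"
    then show "x \<in> range const - {\<zero>\<^bsub>S_ring n\<^esub>}" by (auto simp: Units_def)
  next
    fix x assume "x \<in> range const - {\<zero>\<^bsub>S_ring n\<^esub>}"
    then obtain c where c: "x = const c" "c \<noteq> 0" using const_0 by fastforce
    then have "const (inverse c) * const c = 1" "const c * const (inverse c) = 1"
      by (simp_all flip: const_mult add: const_1)
    then show "x \<in> Units (S_ring n\<lparr>carrier := range const\<rparr>)"
      unfolding Units_def using c by auto
  qed
qed

lemma residue_class_hom: "ring_hom_ring (S_ring n) (R_ring n d) (residue_class n d)"
  using ideal.rcos_ring_hom_ring[OF ideal_I[of n d]]
  by (simp add: R_ring_def residue_class_def[abs_def])

lemma residue_class_eq_iff: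
  assumes "p \<in> carrier (S_ring n)" "q \<in> carrier (S_ring n)"
  shows "residue_class n d p = residue_class n d q \<longleftrightarrow> p - q \<in> I_ideal n d"
  using S.quotient_eq_iff_same_a_r_cos[OF ideal_I assms, of d] S_minus[OF assms]
  by (simp add: residue_class_def)

text \<open>
  The criterion by which all dimensions are computed: \<open>p\<close> is a basis of the image of \<open>W\<close> in \<open>R\<close>
  as soon as it has a dual family \<open>f\<close> of functionals that vanish on the ideal, and the vectors of
  \<open>W\<close> on which all the functionals vanish lie in the ideal (\<open>spans\<close>).
\<close>

lemma R_dim_eq_card:
  fixes f :: "'i \<Rightarrow> cpoly \<Rightarrow> complex" and p :: "'i \<Rightarrow> cpoly"
  assumes d: "d > 0" and fin: "finite A"
    and W: "W \<subseteq> carrier (S_ring n)" "0 \<in> W" "\<And>u v. u \<in> W \<Longrightarrow> v \<in> W \<Longrightarrow> u + v \<in> W"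
      "\<And>c u. u \<in> W \<Longrightarrow> const c * u \<in> W"
    and p: "\<And>a. a \<in> A \<Longrightarrow> p a \<in> W"
    and add: "\<And>a u v. f a (u + v) = f a u + f a v"
    and scale: "\<And>a c u. f a (const c * u) = c * f a u"
    and I: "\<And>a u. a \<in> A \<Longrightarrow> u \<in> I_ideal n d \<Longrightarrow> f a u = 0"
    and dual: "\<And>a b. a \<in> A \<Longrightarrow> b \<in> A \<Longrightarrow> f a (p b) = (if a = b then 1 else 0)"
    and spans: "\<And>w. w \<in> W \<Longrightarrow> w - (\<Sum>a\<in>A. const (f a w) * p a) \<in> I_ideal n d"
  shows "R_dim n d (residue_class n d ` W) = card A"
proof -
  let ?rc = "residue_class n d" and ?K = "residue_class n d ` range const"
  interpret h: ring_hom_ring "S_ring n" "R_ring n d" "?rc"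
    by (rule residue_class_hom)
  have one: "\<one>\<^bsub>R_ring n d\<^esub> \<noteq> \<zero>\<^bsub>R_ring n d\<^esub>"
    using residue_class_eq_iff[of 1 n 0 d] one_notin_I[OF d] h.hom_one h.hom_zero by simp
  have K: "subfield ?K (R_ring n d)"
    by (rule h.img_is_subfield(2)[OF subfield_const one])
  \<comment> \<open>The images of the spans of finite subfamilies grow by one line extension per basis vector.\<close>
  define comb where "comb B c = (\<Sum>a\<in>B. const (c a) * p a)" for B and c :: "'i \<Rightarrow> complex"
  have comb_W: "comb B c \<in> W" if "B \<subseteq> A" for B c
    using finite_subset[OF that fin] that unfolding comb_def
    by (induction B rule: finite_induct) (auto intro: W p)
  have comb_S: "comb B c \<in> carrier (S_ring n)" if "B \<subseteq> A" for B c
    using comb_W[OF that] W(1) by blast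
  have f0: "f a 0 = 0" for a using add[of a 0 0] by simp
  have f_comb: "f a (comb B c) = (\<Sum>b\<in>B. c b * f a (p b))" for a B c
    unfolding comb_def
    by (induction B rule: infinite_finite_induct) (auto simp: f0 add scale)
  have f_cong: "f a u = f a v"
    if a: "a \<in> A" and uv: "u \<in> carrier (S_ring n)" "v \<in> carrier (S_ring n)" "?rc u = ?rc v" for a u v
  proof -
    have "u - v \<in> I_ideal n d" using uv residue_class_eq_iff by blast
    from I[OF a this] add[of a "u - v" v] show ?thesis by simp
  qed
  have dim: "h.S.dimension (card B) ?K (?rc ` range (comb B))" if "B \<subseteq> A" for B
    using finite_subset[OF that fin] that
  proof (induction B rule: finite_induct)
    case empty
    have "?rc ` range (comb {}) = {\<zero>\<^bsub>R_ring n d\<^esub>}"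
      using h.hom_zero by (auto simp: comb_def)
    then show ?case by simp
  next
    case (insert b B)
    have bA: "b \<in> A" and BA: "B \<subseteq> A" using insert by auto
    have pb: "p b \<in> carrier (S_ring n)" using p[OF bA] W(1) by blast
    have notin: "?rc (p b) \<notin> ?rc ` range (comb B)"
    proof
      assume "?rc (p b) \<in> ?rc ` range (comb B)"
      then obtain c where c: "?rc (p b) = ?rc (comb B c)" by blast
      have "f b (p b) = f b (comb B c)"
        by (rule f_cong[OF bA pb comb_S[OF BA] c])
      also have "\<dots> = 0"
      proof -
        have "f b (p x) = 0" if "x \<in> B" for x
          using dual[OF bA, of x] that BA insert.hyps by auto
        then show ?thesis by (simp add: f_comb)
      qed
      finally show False using dual[OF bA bA] by simp
    qed
    have rc_comb: "?rc (const k * p b + comb B c) =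
        ?rc (const k) \<otimes>\<^bsub>R_ring n d\<^esub> ?rc (p b) \<oplus>\<^bsub>R_ring n d\<^esub> ?rc (comb B c)"
      for k c
      using h.hom_add[of "const k * p b" "comb B c"] h.hom_mult[of "const k" "p b"]
        S_mult_closed[OF const_closed pb, of k] const_closed[of k n] pb comb_S[OF BA, of c]
      by (simp del: carrier_S)
    have "?rc ` range (comb (insert b B)) = h.S.line_extension ?K (?rc (p b)) (?rc ` range (comb B))"
    proof (intro equalityI subsetI)
      fix x assume "x \<in> ?rc ` range (comb (insert b B))"
      then obtain c where "x = ?rc (const (c b) * p b + comb B c)"
        using insert.hyps by (auto simp: comb_def)
      then show "x \<in> h.S.line_extension ?K (?rc (p b)) (?rc ` range (comb B))"
        unfolding h.S.line_extension_mem_iff rc_comb by blast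
    next
      fix x assume "x \<in> h.S.line_extension ?K (?rc (p b)) (?rc ` range (comb B))"
      then obtain k c where "x = ?rc (const k * p b + comb B c)"
        unfolding h.S.line_extension_mem_iff using rc_comb by auto
      also have "const k * p b + comb B c = comb (insert b B) (c(b := k))"
        using insert.hyps by (auto simp: comb_def intro!: sum.cong)
      finally show "x \<in> ?rc ` range (comb (insert b B))" by blast
    qed
    moreover have "?rc (p b) \<in> carrier (R_ring n d)" using pb by (rule h.hom_closed)
    ultimately show ?case
      using h.S.dimension.Suc_dim[OF _ notin insert.IH[OF BA]] insert.hyps by simp
  qed
  have "?rc ` range (comb A) = ?rc ` W"
  proof (intro equalityI subsetI)
    fix x assume "x \<in> ?rc ` W"
    then obtain w where w: "w \<in> W" "x = ?rc w" by blast
    have "?rc w = ?rc (comb A (\<lambda>a. f a w))"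
      using spans[OF w(1)] w(1) W(1) comb_S[of A] residue_class_eq_iff
      by (simp add: comb_def subset_iff del: carrier_S)
    then show "x \<in> ?rc ` range (comb A)" using w by blast
  qed (use comb_W in auto)
  then have "h.S.dimension (card A) ?K (?rc ` W)" using dim[of A] by simp
  then show ?thesis
    using h.S.dimI[OF K] unfolding R_dim_def over_def by blast
qed

section \<open>Parity classes and Newton interpolation on them\<close>

text \<open>
  The monomials of degree \<open>i\<close> in the variables \<open>x\<^sub>0, \<dots>, x\<^sub>n\<close>.
\<close>

definition mons :: "nat \<Rightarrow> nat \<Rightarrow> monom set"
  where "mons n i = {b. Poly_Mapping.keys b \<subseteq> {..n} \<and> mdeg n b = i}"

text \<open>
  A monomial is \<open>x\<^sup>h (x\<^sup>c)\<^sup>2\<close> with \<open>h\<close> its vector of parities and \<open>c\<close> its vector of halved exponents.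
\<close>

definition half :: "monom \<Rightarrow> nat \<Rightarrow> nat"
  where "half b k = Poly_Mapping.lookup b k div 2"

text \<open>
  The monomials of the same degree and parities as a reference monomial \<open>b0\<close>.
\<close>

definition parity_class :: "nat \<Rightarrow> monom \<Rightarrow> monom set"
  where "parity_class n b0 = {b \<in> mons n (mdeg n b0).
    \<forall>k\<le>n. even (Poly_Mapping.lookup b k) \<longleftrightarrow> even (Poly_Mapping.lookup b0 k)}"

text \<open>
  The monomial with exponents \<open>f 0, \<dots>, f n\<close>; the values of \<open>f\<close> beyond \<open>n\<close> are ignored.
\<close>

definition monom_of :: "nat \<Rightarrow> (nat \<Rightarrow> nat) \<Rightarrow> monom"
  where "monom_of n f = (\<Sum>k\<le>n. Poly_Mapping.single k (f k))"

lemma lookup_monom_of: "Poly_Mapping.lookup (monom_of n f) k = (if k \<le> n then f k else 0)"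
  by (auto simp: monom_of_def lookup_sum lookup_single when_def sum.delta)

lemma keys_monom_of: "Poly_Mapping.keys (monom_of n f) \<subseteq> {..n}"
  by (auto simp: in_keys_iff lookup_monom_of split: if_splits)

lemma monom_of_lookup: "Poly_Mapping.keys b \<subseteq> {..n} \<Longrightarrow> (\<And>k. k \<le> n \<Longrightarrow> f k = Poly_Mapping.lookup b k) \<Longrightarrow>
    monom_of n f = b"
  by (rule poly_mapping_eqI) (auto simp: lookup_monom_of in_keys_iff subset_iff)

lemma mdeg_monom_of: "mdeg n (monom_of n f) = sum f {..n}"
  by (simp add: mdeg_def lookup_monom_of)

lemma mdeg_add: "mdeg n (a + b) = mdeg n a + mdeg n b"
  by (simp add: mdeg_def lookup_add sum.distrib)

lemma lookup_le_mdeg: "k \<le> n \<Longrightarrow> Poly_Mapping.lookup b k \<le> mdeg n b"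
  unfolding mdeg_def by (intro member_le_sum) auto

lemma finite_mons: "finite (mons n i)"
proof (rule finite_subset)
  show "mons n i \<subseteq> monom_of n ` ({..n} \<rightarrow>\<^sub>E {..i})"
  proof
    fix b assume b: "b \<in> mons n i"
    then have "b = monom_of n (restrict (Poly_Mapping.lookup b) {..n})"
      by (subst monom_of_lookup[of b]) (auto simp: mons_def)
    moreover have "restrict (Poly_Mapping.lookup b) {..n} \<in> {..n} \<rightarrow>\<^sub>E {..i}"
      using b lookup_le_mdeg by (auto simp: mons_def)
    ultimately show "b \<in> monom_of n ` ({..n} \<rightarrow>\<^sub>E {..i})" by blast
  qed
  show "finite (monom_of n ` ({..n} \<rightarrow>\<^sub>E {..i}))"
    by (intro finite_imageI finite_PiE) auto
qed

lemma parity_class_subset: "parity_class n b0 \<subseteq> mons n (mdeg n b0)"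
  by (auto simp: parity_class_def)

lemma finite_parity_class: "finite (parity_class n b0)"
  by (rule finite_subset[OF parity_class_subset finite_mons])

lemma parity_class_sym: "b0 \<in> mons n i \<Longrightarrow> b \<in> parity_class n b0 \<Longrightarrow> b0 \<in> parity_class n b"
  by (auto simp: parity_class_def mons_def)

lemma parity_class_self: "b0 \<in> mons n i \<Longrightarrow> b0 \<in> parity_class n b0"
  by (auto simp: parity_class_def mons_def)

lemma parity_class_eq: "b \<in> parity_class n b0 \<Longrightarrow> parity_class n b = parity_class n b0"
  by (auto simp: parity_class_def mons_def)

lemma sum_atMost_split: "(\<Sum>k\<le>n. f k) = f 0 + (\<Sum>k=1..n. f k)" for f :: "nat \<Rightarrow> 'a :: comm_monoid_add"
proof -
  have "{..n} = insert 0 {1..n}" by auto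
  then show ?thesis by simp
qed

lemma prod_atMost_split: "(\<Prod>k\<le>n. f k) = f 0 * (\<Prod>k=1..n. f k)" for f :: "nat \<Rightarrow> 'a :: comm_monoid_mult"
proof -
  have "{..n} = insert 0 {1..n}" by auto
  then show ?thesis by simp
qed

text \<open>
  On a parity class the sum of all halved exponents is a constant \<open>e\<close>, so the halved exponents
  \<open>g 1, \<dots>, g n\<close> are coordinates on the class, and range over the simplex \<open>g 1 + \<dots> + g n \<le> e\<close>.
  The inverse of this coordinate map fills in the exponent of \<open>x\<^sub>0\<close>.
\<close>

definition lift :: "nat \<Rightarrow> monom \<Rightarrow> (nat \<Rightarrow> nat) \<Rightarrow> monom"
  where "lift n b0 g = monom_of n (\<lambda>k. Poly_Mapping.lookup b0 k mod 2 +
    2 * (if k = 0 then (\<Sum>k\<le>n. half b0 k) - (\<Sum>k=1..n. g k) else g k))"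

lemma mdeg_half: "mdeg n b = (\<Sum>k\<le>n. Poly_Mapping.lookup b k mod 2) + 2 * (\<Sum>k\<le>n. half b k)"
  by (simp add: mdeg_def half_def sum_distrib_left flip: sum.distrib)

lemma half_lift: "k \<in> {1..n} \<Longrightarrow> half (lift n b0 g) k = g k"
  by (auto simp: half_def lift_def lookup_monom_of)

lemma lift_in_class:
  assumes "(\<Sum>k=1..n. g k) \<le> (\<Sum>k\<le>n. half b0 k)"
  shows "lift n b0 g \<in> parity_class n b0"
proof -
  have "mdeg n (lift n b0 g) = (\<Sum>k\<le>n. Poly_Mapping.lookup b0 k mod 2) +
      2 * ((\<Sum>k\<le>n. half b0 k) - (\<Sum>k=1..n. g k) + (\<Sum>k=1..n. g k))"
    unfolding lift_def mdeg_monom_of sum.distrib sum_atMost_split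
    by (simp add: sum_distrib_left)
  then have "mdeg n (lift n b0 g) = mdeg n b0"
    using assms by (simp add: mdeg_half[of n b0])
  moreover have "even (Poly_Mapping.lookup (lift n b0 g) k) \<longleftrightarrow>
      even (Poly_Mapping.lookup b0 k)" if "k \<le> n" for k
    using that by (auto simp: lift_def lookup_monom_of)
  ultimately show ?thesis
    by (auto simp: parity_class_def mons_def lift_def keys_monom_of[THEN subsetD, simplified])
qed

lemma parity_class_half_sum:
  assumes "b \<in> parity_class n b0"
  shows "(\<Sum>k\<le>n. half b k) = (\<Sum>k\<le>n. half b0 k)"
proof -
  have "(\<Sum>k\<le>n. Poly_Mapping.lookup b k mod 2) = (\<Sum>k\<le>n. Poly_Mapping.lookup b0 k mod 2)"
    using assms by (intro sum.cong) (auto simp: parity_class_def mod_2_eq_odd)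
  moreover have "mdeg n b = mdeg n b0" using assms by (auto simp: parity_class_def mons_def)
  ultimately show ?thesis by (simp add: mdeg_half)
qed

lemma lift_half:
  assumes b: "b \<in> parity_class n b0" and g: "\<And>k. k \<in> {1..n} \<Longrightarrow> g k = half b k"
  shows "lift n b0 g = b"
  unfolding lift_def
proof (rule monom_of_lookup)
  show "Poly_Mapping.keys b \<subseteq> {..n}" using b by (auto simp: parity_class_def mons_def)
  fix k assume k: "k \<le> n"
  have "Poly_Mapping.lookup b0 k mod 2 = Poly_Mapping.lookup b k mod 2"
    using b k by (auto simp: parity_class_def mod_2_eq_odd)
  moreover have "(\<Sum>k\<le>n. half b0 k) - (\<Sum>k=1..n. g k) = half b 0"
  proof -
    have "(\<Sum>k=1..n. g k) = (\<Sum>k=1..n. half b k)" using g by (intro sum.cong) auto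
    then show ?thesis using parity_class_half_sum[OF b] by (simp add: sum_atMost_split)
  qed
  moreover have "k \<noteq> 0 \<Longrightarrow> g k = half b k" using g k by auto
  ultimately show "Poly_Mapping.lookup b0 k mod 2 +
      2 * (if k = 0 then (\<Sum>k\<le>n. half b0 k) - (\<Sum>k=1..n. g k) else g k) = Poly_Mapping.lookup b k"
    by (simp add: half_def)
qed

text \<open>
  A sum over a parity class of a product of functions of the coordinates is a product of
  one-dimensional sums if the box on which the product is supported lies in the simplex.
\<close>

lemma sum_parity_class:
  fixes F :: "nat \<Rightarrow> nat \<Rightarrow> complex"
  assumes u: "(\<Sum>k=1..n. u k) \<le> (\<Sum>k\<le>n. half b0 k)"
    and F: "\<And>k x. k \<in> {1..n} \<Longrightarrow> x > u k \<Longrightarrow> F k x = 0"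
  shows "(\<Sum>b\<in>parity_class n b0. \<Prod>k=1..n. F k (half b k)) = (\<Prod>k=1..n. \<Sum>x\<le>u k. F k x)"
proof -
  let ?C = "{b \<in> parity_class n b0. \<forall>k\<in>{1..n}. half b k \<le> u k}"
  let ?P = "PiE {1..n} (\<lambda>k. {..u k})"
  have "(\<Prod>k=1..n. \<Sum>x\<le>u k. F k x) = (\<Sum>g\<in>?P. \<Prod>k=1..n. F k (g k))"
    by (rule prod_sum_PiE) auto
  also have "\<dots> = (\<Sum>b\<in>?C. \<Prod>k=1..n. F k (half b k))"
  proof (rule sum.reindex_bij_witness[where i = "\<lambda>b. restrict (half b) {1..n}" and j = "lift n b0"])
    fix g assume g: "g \<in> ?P"
    have le: "(\<Sum>k=1..n. g k) \<le> (\<Sum>k\<le>n. half b0 k)"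
      using g by (intro order.trans[OF sum_mono u]) auto
    show "restrict (half (lift n b0 g)) {1..n} = g"
      using g by (auto simp: half_lift PiE_def extensional_def fun_eq_iff restrict_def)
    show "lift n b0 g \<in> ?C" using lift_in_class[OF le] g half_lift by auto
    show "(\<Prod>k=1..n. F k (half (lift n b0 g) k)) = (\<Prod>k=1..n. F k (g k))"
      by (intro prod.cong) (auto simp: half_lift)
  next
    fix b assume b: "b \<in> ?C"
    then show "lift n b0 (restrict (half b) {1..n}) = b" by (intro lift_half) auto
    show "restrict (half b) {1..n} \<in> ?P" using b by auto
  qed
  also have "\<dots> = (\<Sum>b\<in>parity_class n b0. \<Prod>k=1..n. F k (half b k))"
  proof (rule sum.mono_neutral_left)
    show "\<forall>b\<in>parity_class n b0 - ?C. (\<Prod>k=1..n. F k (half b k)) = 0"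
    proof
      fix b assume "b \<in> parity_class n b0 - ?C"
      then obtain k where "k \<in> {1..n}" "half b k > u k" by (auto simp: not_le)
      then show "(\<Prod>k=1..n. F k (half b k)) = 0" using F by (intro prod_zero bexI[of _ k]) auto
    qed
  qed (auto intro: finite_parity_class)
  finally show ?thesis by simp
qed

lemma alternating_binomial_product:
  "(\<Sum>x\<le>a. (- 1) ^ x * of_nat (a choose x) * of_nat (x choose b)) =
     (if a = b then (- 1) ^ a else (0 :: complex))"
proof (cases "b \<le> a")
  case False
  then show ?thesis by (auto simp: binomial_eq_0)
next
  case True
  have "(\<Sum>x\<le>a. (- 1) ^ x * of_nat (a choose x) * of_nat (x choose b)) =
      (\<Sum>x=b..a. (- 1) ^ x * of_nat (a choose x) * (of_nat (x choose b) :: complex))"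
    by (rule sum.mono_neutral_right) (auto simp: binomial_eq_0)
  also have "\<dots> = (\<Sum>x=b..a. (- 1) ^ x * of_nat (a choose b) * of_nat ((a - b) choose (x - b)))"
    by (intro sum.cong refl) (auto simp: choose_mult mult.assoc simp flip: of_nat_mult)
  also have "\<dots> = (\<Sum>x\<le>a - b. (- 1) ^ (x + b) * of_nat (a choose b) * of_nat ((a - b) choose x))"
    by (rule sum.reindex_bij_witness[of _ "\<lambda>x. x + b" "\<lambda>x. x - b"]) (use True in auto)
  also have "\<dots> = (- 1) ^ b * of_nat (a choose b) * (\<Sum>x\<le>a - b. (- 1) ^ x * of_nat ((a - b) choose x))"
    by (simp add: sum_distrib_left power_add mult_ac)
  also have "\<dots> = (if a = b then (- 1) ^ a else 0)"
    using True choose_alternating_sum[of "a - b", where 'a = complex] by auto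
  finally show ?thesis .
qed

text \<open>
  The Newton basis functions \<open>\<Prod>\<^sub>k binomial(c\<^sub>k, \<alpha>\<^sub>k)\<close> in the coordinates \<open>c\<close> of a monomial. Only
  the values of \<open>\<alpha>\<close> at \<open>1, \<dots>, n\<close> matter.
\<close>

definition newton_val :: "nat \<Rightarrow> (nat \<Rightarrow> nat) \<Rightarrow> monom \<Rightarrow> complex"
  where "newton_val n \<alpha> b = (\<Prod>k=1..n. of_nat (half b k choose \<alpha> k))"

text \<open>
  The coefficients of the iterated difference operator \<open>\<Delta>\<^sup>\<alpha>\<close> at the origin, which reads off the
  Newton coefficient at \<open>\<alpha>\<close>.
\<close>

definition newton_wt :: "nat \<Rightarrow> (nat \<Rightarrow> nat) \<Rightarrow> monom \<Rightarrow> complex"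
  where "newton_wt n \<alpha> b = (\<Prod>k=1..n. (- 1) ^ (\<alpha> k + half b k) * of_nat (\<alpha> k choose half b k))"

lemma prod_delta: "finite K \<Longrightarrow> (\<Prod>k\<in>K. if P k then 1 else 0) = (if \<forall>k\<in>K. P k then 1 else (0 :: complex))"
  by (induction K rule: finite_induct) auto

lemma newton_orthogonal:
  assumes "(\<Sum>k=1..n. \<alpha> k) \<le> (\<Sum>k\<le>n. half b0 k)"
  shows "(\<Sum>b\<in>parity_class n b0. newton_wt n \<alpha> b * newton_val n \<beta> b) =
     (if \<forall>k\<in>{1..n}. \<alpha> k = \<beta> k then 1 else 0)"
proof -
  let ?F = "\<lambda>k x. (- 1) ^ (\<alpha> k + x) * of_nat (\<alpha> k choose x) * (of_nat (x choose \<beta> k) :: complex)"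
  have "(\<Sum>b\<in>parity_class n b0. newton_wt n \<alpha> b * newton_val n \<beta> b) =
      (\<Sum>b\<in>parity_class n b0. \<Prod>k=1..n. ?F k (half b k))"
    by (simp add: newton_wt_def newton_val_def prod.distrib)
  also have "\<dots> = (\<Prod>k=1..n. \<Sum>x\<le>\<alpha> k. ?F k x)"
    by (rule sum_parity_class[OF assms]) (auto simp: binomial_eq_0)
  also have "\<dots> = (\<Prod>k=1..n. if \<alpha> k = \<beta> k then 1 else 0)"
  proof (rule prod.cong[OF refl])
    fix k
    have "(\<Sum>x\<le>\<alpha> k. ?F k x) =
        (- 1) ^ \<alpha> k * (\<Sum>x\<le>\<alpha> k. (- 1) ^ x * of_nat (\<alpha> k choose x) * of_nat (x choose \<beta> k))"
      by (simp add: sum_distrib_left power_add mult_ac)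
    then show "(\<Sum>x\<le>\<alpha> k. ?F k x) = (if \<alpha> k = \<beta> k then 1 else 0)"
      unfolding alternating_binomial_product by simp
  qed
  finally show ?thesis by (simp add: prod_delta)
qed

text \<open>
  Newton interpolation: every function on a parity class is the combination of Newton basis
  functions whose coefficients are its iterated differences. Here this is stated for the
  indicator function of \<open>b'\<close>, evaluated at \<open>b\<close>.
\<close>

lemma newton_inversion:
  assumes b: "b \<in> parity_class n b0" and b': "b' \<in> parity_class n b0"
  shows "(\<Sum>c\<in>parity_class n b0. newton_val n (half c) b * newton_wt n (half c) b') =
     (if b = b' then 1 else 0)"
proof -
  let ?F = "\<lambda>k x. of_nat (half b k choose x) * ((- 1) ^ (x + half b' k) *
      (of_nat (x choose half b' k) :: complex))"
  have "(\<Sum>c\<in>parity_class n b0. newton_val n (half c) b * newton_wt n (half c) b') =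
      (\<Sum>c\<in>parity_class n b0. \<Prod>k=1..n. ?F k (half c k))"
    by (simp add: newton_wt_def newton_val_def prod.distrib)
  also have "\<dots> = (\<Prod>k=1..n. \<Sum>x\<le>half b k. ?F k x)"
    using parity_class_half_sum[OF b] by (intro sum_parity_class)
        (auto simp: binomial_eq_0 sum_atMost_split[of "half b"])
  also have "\<dots> = (\<Prod>k=1..n. if half b k = half b' k then 1 else 0)"
  proof (rule prod.cong[OF refl])
    fix k
    have "(\<Sum>x\<le>half b k. ?F k x) = (- 1) ^ half b' k *
        (\<Sum>x\<le>half b k. (- 1) ^ x * of_nat (half b k choose x) * of_nat (x choose half b' k))"
      by (simp add: sum_distrib_left power_add mult_ac)
    then show "(\<Sum>x\<le>half b k. ?F k x) = (if half b k = half b' k then 1 else 0)"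
      unfolding alternating_binomial_product by simp
  qed
  also have "\<dots> = (if b = b' then 1 else (0 :: complex))"
    using lift_half[OF b] lift_half[OF b', of "half b"] by (auto simp: prod_delta)
  finally show ?thesis .
qed

section \<open>Coefficients of multiples of powers of linear forms\<close>

text \<open>
  The factorial \<open>b! = b\<^sub>0! \<cdots> b\<^sub>n!\<close> of an exponent vector.
\<close>

definition mfact :: "nat \<Rightarrow> monom \<Rightarrow> complex"
  where "mfact n b = (\<Prod>k\<le>n. fact (Poly_Mapping.lookup b k))"

text \<open>
  The value of the monomial \<open>b\<close> at the point \<open>\<epsilon>\<close>.
\<close>

definition sign_val :: "nat \<Rightarrow> (nat \<Rightarrow> complex) \<Rightarrow> monom \<Rightarrow> complex"
  where "sign_val n \<epsilon> b = (\<Prod>k\<le>n. \<epsilon> k ^ Poly_Mapping.lookup b k)"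

text \<open>
  The form \<open>\<ell>\<^sub>\<epsilon> = \<epsilon>\<^sub>0 x\<^sub>0 + \<dots> + \<epsilon>\<^sub>n x\<^sub>n\<close>.
\<close>

definition linear_form :: "nat \<Rightarrow> (nat \<Rightarrow> complex) \<Rightarrow> cpoly"
  where "linear_form n \<epsilon> = (\<Sum>k\<le>n. const (\<epsilon> k) * var k)"

text \<open>
  The product of the falling factorials \<open>b\<^sub>k (b\<^sub>k - 1) \<cdots> (b\<^sub>k - a\<^sub>k + 1)\<close>. It is \<open>b! / (b - a)!\<close> if
  \<open>a\<close> divides \<open>b\<close>, and zero otherwise.
\<close>

definition falling :: "nat \<Rightarrow> monom \<Rightarrow> monom \<Rightarrow> complex"
  where "falling n a b = (\<Prod>k\<le>n. \<Prod>t<Poly_Mapping.lookup a k. of_nat (Poly_Mapping.lookup b k) - of_nat t)"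

text \<open>
  The \<open>2\<^sup>n\<close> sign vectors, normalised by \<open>\<epsilon>\<^sub>0 = 1\<close>.
\<close>

definition signs :: "nat \<Rightarrow> (nat \<Rightarrow> complex) set"
  where "signs n = PiE {..n} (\<lambda>k. if k = 0 then {1} else {1, - 1})"

lemma mfact_nonzero [simp]: "mfact n b \<noteq> 0"
  by (simp add: mfact_def)

lemma sign_val_add: "sign_val n \<epsilon> (a + b) = sign_val n \<epsilon> a * sign_val n \<epsilon> b"
  by (simp add: sign_val_def lookup_add power_add prod.distrib)

lemma sign_val_single: "k \<le> n \<Longrightarrow> sign_val n \<epsilon> (Poly_Mapping.single k 1) = \<epsilon> k"
proof -
  assume k: "k \<le> n"
  have "\<epsilon> j ^ Poly_Mapping.lookup (Poly_Mapping.single k (1 :: nat)) j =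
      (if k = j then \<epsilon> j else 1)" for j
    by (auto simp: lookup_single)
  then show ?thesis using k by (simp add: sign_val_def prod.delta)
qed

lemma mfact_add_single:
  assumes "k \<le> n"
  shows "mfact n (Poly_Mapping.single k 1 + b) = of_nat (Suc (Poly_Mapping.lookup b k)) * mfact n b"
proof -
  have "fact (Poly_Mapping.lookup (Poly_Mapping.single k 1 + b) j) =
      (if k = j then of_nat (Suc (Poly_Mapping.lookup b k)) else 1) *
          (fact (Poly_Mapping.lookup b j) :: complex)" for j
    by (auto simp: lookup_add lookup_single)
  then show ?thesis using assms by (simp add: mfact_def prod.distrib prod.delta)
qed

lemma mdeg_single: "k \<le> n \<Longrightarrow> mdeg n (Poly_Mapping.single k 1) = 1"
proof -
  assume k: "k \<le> n"
  have "Poly_Mapping.lookup (Poly_Mapping.single k (1 :: nat)) j = (if k = j then 1 else 0)" for j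
    by (auto simp: lookup_single)
  then show ?thesis using k by (simp add: mdeg_def sum.delta)
qed

lemma monom_le_iff: "(\<exists>m. b = a + m) \<longleftrightarrow> (\<forall>k. Poly_Mapping.lookup a k \<le> Poly_Mapping.lookup b k)" for a b :: monom
proof
  assume le: "\<forall>k. Poly_Mapping.lookup a k \<le> Poly_Mapping.lookup b k"
  have "b = a + (b - a)"
    by (rule poly_mapping_eqI) (simp add: lookup_add lookup_minus le)
  then show "\<exists>m. b = a + m" by blast
qed (auto simp: lookup_add)

lemma lookup_var_mult:
  "Poly_Mapping.lookup (var k * q) b =
      (if Poly_Mapping.lookup b k = 0 then 0 else Poly_Mapping.lookup q (b - Poly_Mapping.single k 1))"
proof -
  have "(\<exists>m. b = Poly_Mapping.single k 1 + m) \<longleftrightarrow> Poly_Mapping.lookup b k \<noteq> 0"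
    unfolding monom_le_iff by (auto simp: lookup_single when_def)
  then show ?thesis by (simp add: var_def single_mult_lookup)
qed

text \<open>
  The multinomial theorem.
\<close>

lemma lookup_linear_form_power:
  assumes "Poly_Mapping.keys b \<subseteq> {..n}"
  shows "Poly_Mapping.lookup (linear_form n \<epsilon> ^ N) b =
     (if mdeg n b = N then fact N * sign_val n \<epsilon> b / mfact n b else 0)"
  using assms
proof (induction N arbitrary: b)
  case 0
  have "mdeg n b = 0 \<longleftrightarrow> b = 0"
    using 0 by (auto simp: mdeg_def poly_mapping_eq_iff fun_eq_iff in_keys_iff subset_iff)
  then show ?case by (auto simp: lookup_one mfact_def sign_val_def mdeg_def)
next
  case (Suc N)
  let ?x = "\<lambda>k. Poly_Mapping.single k (1 :: nat)"
  have summand: "Poly_Mapping.lookup (var k * linear_form n \<epsilon> ^ N) b * \<epsilon> k =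
      (if mdeg n b = Suc N then fact N * sign_val n \<epsilon> b / mfact n b *
          of_nat (Poly_Mapping.lookup b k) else 0)"
    if k: "k \<le> n" for k
  proof (cases "Poly_Mapping.lookup b k = 0")
    case False
    define m where "m = b - ?x k"
    have b: "b = ?x k + m"
      using False unfolding m_def
      by (intro poly_mapping_eqI) (auto simp: lookup_add lookup_minus lookup_single when_def)
    have "Poly_Mapping.keys m \<subseteq> {..n}" using Suc.prems unfolding b by (simp add: keys_monom_add)
    then have "Poly_Mapping.lookup (linear_form n \<epsilon> ^ N) m =
        (if mdeg n m = N then fact N * sign_val n \<epsilon> m / mfact n m else 0)"
      by (rule Suc.IH)
    moreover have "Poly_Mapping.lookup b k = Suc (Poly_Mapping.lookup m k)"
      unfolding b by (simp add: lookup_add)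
    moreover have "mdeg n b = Suc (mdeg n m)"
      using k by (simp add: b mdeg_add mdeg_single del: One_nat_def)
    moreover have "mfact n b = of_nat (Suc (Poly_Mapping.lookup m k)) * mfact n m"
      using k unfolding b by (rule mfact_add_single)
    moreover have "sign_val n \<epsilon> b = \<epsilon> k * sign_val n \<epsilon> m"
      using k by (simp add: b sign_val_add sign_val_single del: One_nat_def)
    ultimately show ?thesis
      using False by (simp add: lookup_var_mult flip: m_def del: of_nat_Suc One_nat_def)
  qed (simp add: lookup_var_mult)
  have "Poly_Mapping.lookup (linear_form n \<epsilon> ^ Suc N) b =
      (\<Sum>k\<le>n. Poly_Mapping.lookup (var k * linear_form n \<epsilon> ^ N) b * \<epsilon> k)"
    by (simp add: linear_form_def[of n \<epsilon>] sum_distrib_right lookup_sum mult.assoc lookup_const_mult)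
      (simp add: mult.commute)
  also have "\<dots> = (\<Sum>k\<le>n. if mdeg n b = Suc N
      then fact N * sign_val n \<epsilon> b / mfact n b * of_nat (Poly_Mapping.lookup b k) else 0)"
    by (intro sum.cong refl summand) simp
  also have "\<dots> = (if mdeg n b = Suc N then fact N * sign_val n \<epsilon> b / mfact n b *
      of_nat (mdeg n b) else 0)"
    unfolding mdeg_def of_nat_sum sum_distrib_left by auto
  also have "\<dots> = (if mdeg n b = Suc N then fact (Suc N) * sign_val n \<epsilon> b / mfact n b else 0)"
    by simp
  finally show ?case .
qed

lemma falling_fact: "(\<Prod>t<a. of_nat (a + m) - of_nat t) * fact m = (fact (a + m) :: complex)"
proof (induction a)
  case (Suc a)
  have "(\<Prod>t<Suc a. of_nat (Suc a + m) - of_nat t) =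
      (of_nat (Suc a + m) :: complex) * (\<Prod>t<a. of_nat (a + m) - of_nat t)"
    by (simp add: prod.lessThan_Suc_shift del: prod.lessThan_Suc)
  then show ?case using Suc.IH by (simp add: mult.assoc)
qed simp

lemma falling_mfact: "falling n a (a + m) * mfact n m = mfact n (a + m)"
  unfolding falling_def mfact_def
  by (simp add: lookup_add falling_fact flip: prod.distrib del: of_nat_add)

lemma signs_square: "\<epsilon> \<in> signs n \<Longrightarrow> k \<le> n \<Longrightarrow> \<epsilon> k * \<epsilon> k = 1"
  by (auto simp: signs_def PiE_def Pi_def split: if_splits)

lemma sign_val_square: "\<epsilon> \<in> signs n \<Longrightarrow> sign_val n \<epsilon> b * sign_val n \<epsilon> b = 1"
  by (simp add: sign_val_def signs_square flip: prod.distrib power_mult_distrib)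

text \<open>
  The key computation: up to constants and the normalisation by \<open>b!\<close>, the coefficients of a
  monomial multiple \<open>x\<^sup>a \<ell>\<^sub>\<epsilon>\<^sup>N\<close> are \<open>\<epsilon>\<^sup>b\<close> times a polynomial of degree \<open>|a|\<close> in \<open>b\<close>.
\<close>

lemma lookup_monom_linear_form_power:
  assumes \<epsilon>: "\<epsilon> \<in> signs n" and a: "Poly_Mapping.keys a \<subseteq> {..n}" and b: "Poly_Mapping.keys b \<subseteq> {..n}"
  shows "Poly_Mapping.lookup (Poly_Mapping.single a c * linear_form n \<epsilon> ^ N) b =
    (if mdeg n b = mdeg n a + N
     then c * fact N * sign_val n \<epsilon> a * sign_val n \<epsilon> b * falling n a b / mfact n b else 0)"
proof (cases "\<exists>m. b = a + m")
  case True
  then obtain m where m: "b = a + m" by blast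
  have "Poly_Mapping.keys m \<subseteq> {..n}" using b by (simp add: m keys_monom_add)
  moreover have "sign_val n \<epsilon> a * sign_val n \<epsilon> b = sign_val n \<epsilon> m"
    using sign_val_square[OF \<epsilon>, of a] by (simp add: m sign_val_add flip: mult.assoc)
  moreover have "falling n a b / mfact n b = 1 / mfact n m"
    using falling_mfact[of n a m] by (simp add: m field_simps)
  ultimately show ?thesis
    by (simp add: single_mult_lookup lookup_linear_form_power mdeg_add m
        mult.assoc flip: times_divide_eq_right)
      simp
next
  case False
  then obtain k where k: "Poly_Mapping.lookup b k < Poly_Mapping.lookup a k"
    unfolding monom_le_iff by (auto simp: not_le)
  then have "k \<le> n" using a by (auto simp: subset_iff in_keys_iff)
  have "falling n a b = 0"
    unfolding falling_def
    by (rule prod_zero, simp, rule bexI[of _ k], rule prod_zero)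
      (use k \<open>k \<le> n\<close> in auto)
  then show ?thesis using False by (simp add: single_mult_lookup)
qed

lemma linear_form_power_in_I:
  assumes \<epsilon>: "\<epsilon> \<in> signs n" and N: "N \<ge> d"
  shows "linear_form n \<epsilon> ^ N \<in> I_ideal n d"
proof -
  have "\<epsilon> 0 = 1" using \<epsilon> by (auto simp: signs_def PiE_def Pi_def)
  then have eq: "linear_form n \<epsilon> = var 0 + (\<Sum>k=1..n. const (\<epsilon> k) * var k)"
    by (simp add: linear_form_def sum_atMost_split const_1)
  have "\<forall>k\<in>{1..n}. \<epsilon> k \<in> {1, - 1}" using \<epsilon> by (auto simp: signs_def PiE_def Pi_def)
  then have "linear_form n \<epsilon> ^ d \<in> I_ideal n d"
    unfolding eq by (intro I_generator) (auto simp: power_forms_def)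
  moreover have "linear_form n \<epsilon> ^ (N - d) \<in> carrier (S_ring n)"
    unfolding linear_form_def
    by (intro power_closed_S sum_closed_S S_mult_closed const_closed var_closed) auto
  ultimately have "linear_form n \<epsilon> ^ (N - d) * linear_form n \<epsilon> ^ d \<in> I_ideal n d"
    by (rule I_mult)
  then show ?thesis using N by (simp flip: power_add)
qed

lemma power_forms_eq: "power_forms n d = {linear_form n \<epsilon> ^ d | \<epsilon>. \<epsilon> \<in> signs n}"
proof (intro equalityI subsetI)
  fix g assume "g \<in> power_forms n d"
  then obtain \<epsilon> where \<epsilon>: "g = (var 0 + (\<Sum>k = 1..n. const (\<epsilon> k) * var k)) ^ d"
    "\<forall>k\<in>{1..n}. \<epsilon> k \<in> {1, - 1}" unfolding power_forms_def by blast
  define \<delta> where "\<delta> = restrict (\<epsilon>(0 := 1)) {..n}"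
  have "\<delta> \<in> signs n" using \<epsilon>(2) by (auto simp: \<delta>_def signs_def)
  moreover have "g = linear_form n \<delta> ^ d"
    by (simp add: \<epsilon>(1) linear_form_def sum_atMost_split const_1 \<delta>_def)
  ultimately show "g \<in> {linear_form n \<epsilon> ^ d | \<epsilon>. \<epsilon> \<in> signs n}" by blast
next
  fix g assume "g \<in> {linear_form n \<epsilon> ^ d | \<epsilon>. \<epsilon> \<in> signs n}"
  then obtain \<epsilon> where \<epsilon>: "\<epsilon> \<in> signs n" "g = linear_form n \<epsilon> ^ d" by blast
  then have "\<epsilon> 0 = 1" "\<forall>k\<in>{1..n}. \<epsilon> k \<in> {1, - 1}" by (auto simp: signs_def PiE_def Pi_def)
  then show "g \<in> power_forms n d"
    by (auto simp: \<epsilon>(2) power_forms_def linear_form_def sum_atMost_split const_1)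
qed

text \<open>
  The functions of a monomial that are polynomials of degree at most \<open>r\<close> in its exponents.
\<close>

inductive exponent_poly :: "nat \<Rightarrow> nat \<Rightarrow> (monom \<Rightarrow> complex) \<Rightarrow> bool" for n
  where
    one: "exponent_poly n r (\<lambda>b. 1)"
  | mult: "exponent_poly n r q \<Longrightarrow> k \<le> n \<Longrightarrow>
      exponent_poly n (Suc r) (\<lambda>b. of_nat (Poly_Mapping.lookup b k) * q b)"
  | scale: "exponent_poly n r q \<Longrightarrow> exponent_poly n r (\<lambda>b. c * q b)"
  | add: "exponent_poly n r q \<Longrightarrow> exponent_poly n r q' \<Longrightarrow> exponent_poly n r (\<lambda>b. q b + q' b)"

lemma exponent_poly_Suc: "exponent_poly n r q \<Longrightarrow> exponent_poly n (Suc r) q"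
  by (induction rule: exponent_poly.induct) (auto intro: exponent_poly.intros)

lemma exponent_poly_affine:
  assumes "exponent_poly n r q" "k \<le> n"
  shows "exponent_poly n (Suc r) (\<lambda>b. (u * of_nat (Poly_Mapping.lookup b k) - v) * q b)"
  using exponent_poly.add[OF exponent_poly.scale[OF exponent_poly.mult[OF assms], of u]
      exponent_poly.scale[OF exponent_poly_Suc[OF assms(1)], of "- v"]]
  by (simp add: algebra_simps)

lemma exponent_poly_prod:
  assumes "finite K" "K \<subseteq> {..n}"
  shows "exponent_poly n (\<Sum>k\<in>K. a k)
     (\<lambda>b. \<Prod>k\<in>K. \<Prod>t<a k. u * of_nat (Poly_Mapping.lookup b k) - v k t)"
  using assms
proof (induction K rule: finite_induct)
  case empty
  then show ?case by (simp add: exponent_poly.one)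
next
  case (insert k K)
  have "exponent_poly n (m + (\<Sum>k\<in>K. a k)) (\<lambda>b. (\<Prod>t<m. u * of_nat (Poly_Mapping.lookup b k) - v k t) *
      (\<Prod>k\<in>K. \<Prod>t<a k. u * of_nat (Poly_Mapping.lookup b k) - v k t))" for m
  proof (induction m)
    case 0
    then show ?case using insert by simp
  next
    case (Suc m)
    from exponent_poly_affine[OF this, of k u "v k m"] insert.prems show ?case
      by (simp add: mult_ac)
  qed
  then show ?case using insert.hyps by simp
qed

lemma exponent_poly_falling: "exponent_poly n (mdeg n a) (falling n a)"
  using exponent_poly_prod[of "{..n}" n "Poly_Mapping.lookup a" 1 "\<lambda>k t. of_nat t"]
  by (simp add: falling_def[abs_def] mdeg_def)

text \<open>
  The coordinates \<open>c\<^sub>k = (b\<^sub>k - h\<^sub>k) / 2\<close> are affine in the exponents, because the parities \<open>h\<close> are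
  constant on the class.
\<close>

lemma newton_val_exponent_poly:
  "\<exists>q. exponent_poly n (\<Sum>k=1..n. \<alpha> k) q \<and> (\<forall>b\<in>parity_class n b0. q b = newton_val n \<alpha> b)"
proof -
  let ?h = "\<lambda>k. of_nat (Poly_Mapping.lookup b0 k mod 2) :: complex"
  let ?v = "\<lambda>k t. ?h k / 2 + of_nat t"
  define q where "q b = (1 / (\<Prod>k=1..n. fact (\<alpha> k))) *
    (\<Prod>k=1..n. \<Prod>t<\<alpha> k. 1 / 2 * of_nat (Poly_Mapping.lookup b k) - ?v k t)" for b
  have "exponent_poly n (\<Sum>k=1..n. \<alpha> k) q"
    unfolding q_def by (intro exponent_poly.scale exponent_poly_prod) auto
  moreover have "q b = newton_val n \<alpha> b" if b: "b \<in> parity_class n b0" for b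
  proof -
    have "of_nat (half b k choose \<alpha> k) =
        (\<Prod>t<\<alpha> k. 1 / 2 * of_nat (Poly_Mapping.lookup b k) - ?v k t) / fact (\<alpha> k)"
            if k: "k \<in> {1..n}" for k
    proof -
      have "Poly_Mapping.lookup b k = Poly_Mapping.lookup b0 k mod 2 + 2 * half b k"
        using b k by (auto simp: parity_class_def half_def mod_2_eq_odd)
      then have eq: "1 / 2 * of_nat (Poly_Mapping.lookup b k) - ?v k t =
          of_nat (half b k) - of_nat t" for t
        by (simp add: field_simps)
      show ?thesis
        unfolding eq by (simp add: binomial_gbinomial gbinomial_prod_rev lessThan_atLeast0)
    qed
    then show ?thesis
      by (simp add: q_def newton_val_def prod_dividef)
  qed
  ultimately show ?thesis by blast
qed

section \<open>The Newton basis and the ideal\<close>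

text \<open>
  The form of degree \<open>i\<close> with coefficients \<open>\<epsilon>\<^sup>b q(b) / b!\<close>. For \<open>q = 1\<close> it is \<open>\<ell>\<^sub>\<epsilon>\<^sup>i / i!\<close>.
\<close>

definition weighted :: "nat \<Rightarrow> nat \<Rightarrow> (nat \<Rightarrow> complex) \<Rightarrow> (monom \<Rightarrow> complex) \<Rightarrow> cpoly"
  where "weighted n i \<epsilon> q = (\<Sum>b\<in>mons n i. Poly_Mapping.single b (sign_val n \<epsilon> b * q b / mfact n b))"

lemma lookup_sum_single:
  "finite B \<Longrightarrow> Poly_Mapping.lookup (\<Sum>b\<in>B. Poly_Mapping.single b (g b)) b' =
      (if b' \<in> B then g b' else (0 :: complex))"
  by (auto simp: lookup_sum lookup_single when_def sum.delta)

lemma lookup_weighted: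
  "Poly_Mapping.lookup (weighted n i \<epsilon> q) b =
      (if b \<in> mons n i then sign_val n \<epsilon> b * q b / mfact n b else 0)"
  unfolding weighted_def by (rule lookup_sum_single[OF finite_mons])

lemma weighted_add: "weighted n i \<epsilon> (\<lambda>b. q b + q' b) = weighted n i \<epsilon> q + weighted n i \<epsilon> q'"
  by (rule poly_mapping_eqI) (simp add: lookup_weighted lookup_add ring_distribs add_divide_distrib)

lemma weighted_scale: "weighted n i \<epsilon> (\<lambda>b. c * q b) = const c * weighted n i \<epsilon> q"
  by (rule poly_mapping_eqI) (simp add: lookup_weighted lookup_const_mult)

lemma falling_add_single:
  assumes "k \<le> n"
  shows "falling n (Poly_Mapping.single k 1 + a) b =
    (of_nat (Poly_Mapping.lookup b k) - of_nat (Poly_Mapping.lookup a k)) * falling n a b"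
proof -
  let ?f = "\<lambda>j t. of_nat (Poly_Mapping.lookup b j) - of_nat t :: complex"
  have "(\<Prod>t<Poly_Mapping.lookup (Poly_Mapping.single k 1 + a) j. ?f j t) =
      (if k = j then ?f k (Poly_Mapping.lookup a k) else 1) *
          (\<Prod>t<Poly_Mapping.lookup a j. ?f j t)" for j
    by (auto simp: lookup_add lookup_single)
  then show ?thesis using assms by (simp add: falling_def prod.distrib prod.delta)
qed

text \<open>
  This form is a multiple of \<open>x\<^sup>a \<ell>\<^sub>\<epsilon>\<^sup>N\<close> with \<open>N = j + d - |a| \<ge> d\<close>.
\<close>

lemma weighted_falling_in_I:
  assumes \<epsilon>: "\<epsilon> \<in> signs n" and a: "Poly_Mapping.keys a \<subseteq> {..n}" "mdeg n a \<le> j"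
  shows "weighted n (j + d) \<epsilon> (falling n a) \<in> I_ideal n d"
proof -
  define N where "N = j + d - mdeg n a"
  have N: "N \<ge> d" "mdeg n a + N = j + d" using a by (auto simp: N_def)
  have sa: "sign_val n \<epsilon> a \<noteq> 0" using sign_val_square[OF \<epsilon>, of a] by auto
  let ?p = "Poly_Mapping.single a (1 / (fact N * sign_val n \<epsilon> a)) * linear_form n \<epsilon> ^ N"
  have single: "Poly_Mapping.single a (1 / (fact N * sign_val n \<epsilon> a)) \<in> carrier (S_ring n)"
    using a by auto
  have p: "?p \<in> I_ideal n d"
    by (intro I_mult linear_form_power_in_I \<epsilon> N single)
  have "weighted n (j + d) \<epsilon> (falling n a) = ?p"
  proof (rule poly_mapping_eqI)
    fix b
    show "Poly_Mapping.lookup (weighted n (j + d) \<epsilon> (falling n a)) b = Poly_Mapping.lookup ?p b"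
    proof (cases "Poly_Mapping.keys b \<subseteq> {..n}")
      case True
      then show ?thesis using sa N
        by (simp add: lookup_weighted lookup_monom_linear_form_power[OF \<epsilon> a(1)] mons_def)
    next
      case False
      then have "Poly_Mapping.lookup ?p b = 0"
        using I_closed[OF p] by (auto simp: in_keys_iff)
      then show ?thesis using False by (simp add: lookup_weighted mons_def)
    qed
  qed
  with p show ?thesis by simp
qed

text \<open>
  Taking \<open>a = 0\<close> shows that the forms of degree \<open>j + d\<close> belonging to polynomials of degree at most
  \<open>j\<close> in the exponents lie in the ideal. The factor \<open>falling n a\<close> makes the induction work, since
  multiplication of it by \<open>b\<^sub>k\<close> gives \<open>falling n (a + e\<^sub>k) b + a\<^sub>k falling n a b\<close>.
\<close>

lemma weighted_in_I:
  assumes \<epsilon>: "\<epsilon> \<in> signs n" and q: "exponent_poly n r q"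
      and a: "Poly_Mapping.keys a \<subseteq> {..n}" "mdeg n a + r \<le> j"
  shows "weighted n (j + d) \<epsilon> (\<lambda>b. falling n a b * q b) \<in> I_ideal n d"
  using q a
proof (induction arbitrary: a rule: exponent_poly.induct)
  case (one r)
  then show ?case using weighted_falling_in_I[OF \<epsilon>] by simp
next
  case (mult r q k)
  let ?a' = "Poly_Mapping.single k 1 + a"
  have eq: "falling n a b * (of_nat (Poly_Mapping.lookup b k) * q b) =
      falling n ?a' b * q b + of_nat (Poly_Mapping.lookup a k) * (falling n a b * q b)" for b
    by (subst falling_add_single[OF mult.hyps(2)]) (simp add: algebra_simps)
  have "Poly_Mapping.keys ?a' \<subseteq> {..n}" "mdeg n ?a' + r \<le> j"
    using mult.prems mult.hyps(2) by (auto simp: keys_monom_add mdeg_add mdeg_single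
        simp del: One_nat_def)
  moreover have "mdeg n a + r \<le> j" using mult.prems by simp
  ultimately show ?case
    unfolding eq weighted_add weighted_scale
    by (intro I_add I_mult mult.IH const_closed mult.prems)
next
  case (scale r q c)
  have "falling n a b * (c * q b) = c * (falling n a b * q b)" for b by simp
  then show ?case using scale by (simp only: weighted_scale) (intro I_mult const_closed, blast)
next
  case (add r q q')
  then show ?case by (simp only: distrib_left weighted_add) (intro I_add, blast+)
qed

text \<open>
  Averaging over the signs projects to a parity class. The sign of \<open>x\<^sub>0\<close> is fixed, but the parity
  of its exponent is determined by the degree and the other parities.
\<close>

lemma sum_signs:
  assumes "b0 \<in> mons n i" "b \<in> mons n i"
  shows "(\<Sum>\<epsilon>\<in>signs n. sign_val n \<epsilon> b0 * sign_val n \<epsilon> b) = (if b \<in> parity_class n b0 then 2 ^ n else 0)"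
proof -
  let ?l = "Poly_Mapping.lookup"
  have "(\<Sum>\<epsilon>\<in>signs n. sign_val n \<epsilon> b0 * sign_val n \<epsilon> b) = (\<Sum>\<epsilon>\<in>signs n. \<Prod>k\<le>n. \<epsilon> k ^ (?l b0 k + ?l b k))"
    by (simp add: sign_val_def power_add prod.distrib)
  also have "\<dots> = (\<Prod>k\<le>n. \<Sum>s\<in>(if k = 0 then {1} else {1, - 1}). s ^ (?l b0 k + ?l b k))"
    unfolding signs_def by (rule prod_sum_PiE[symmetric]) auto
  also have "\<dots> = (\<Prod>k=1..n. if even (?l b k) \<longleftrightarrow> even (?l b0 k) then 2 else 0)"
    by (simp add: prod_atMost_split) (auto intro!: prod.cong)
  also have "\<dots> = (if \<forall>k\<in>{1..n}. even (?l b k) \<longleftrightarrow> even (?l b0 k) then 2 ^ n else 0)"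
    by (auto intro: prod_zero)
  also have "(\<forall>k\<in>{1..n}. even (?l b k) \<longleftrightarrow> even (?l b0 k)) \<longleftrightarrow> b \<in> parity_class n b0"
  proof
    assume *: "\<forall>k\<in>{1..n}. even (?l b k) \<longleftrightarrow> even (?l b0 k)"
    have "even (mdeg n b + mdeg n b0)" using assms by (simp add: mons_def)
    also have "mdeg n b + mdeg n b0 = (?l b 0 + ?l b0 0) + (\<Sum>k=1..n. ?l b k + ?l b0 k)"
      by (simp add: mdeg_def sum_atMost_split sum.distrib)
    finally have "even (?l b 0) \<longleftrightarrow> even (?l b0 0)"
      using dvd_sum[of "{1..n}" 2 "\<lambda>k. ?l b k + ?l b0 k"] * by auto
    with * have "even (?l b k) \<longleftrightarrow> even (?l b0 k)" if "k \<le> n" for k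
      using that by (cases "k = 0") auto
    then show "b \<in> parity_class n b0" using assms by (auto simp: parity_class_def mons_def)
  qed (auto simp: parity_class_def)
  finally show ?thesis .
qed

text \<open>
  The basis adapted to the ideal. A form supported on one parity class is identified with the
  function that takes \<open>b\<close> to \<open>b!\<close> times the coefficient at \<open>b\<close>. Then \<open>newton_poly n b0\<close> is the
  Newton basis function indexed by the halved exponents of \<open>b0\<close>.
\<close>

definition newton_poly :: "nat \<Rightarrow> monom \<Rightarrow> cpoly"
  where "newton_poly n b0 = (\<Sum>b\<in>parity_class n b0. Poly_Mapping.single b (newton_val n (half b0) b / mfact n b))"

text \<open>
  The functional that extracts the coefficient of \<open>newton_poly n b0\<close>.
\<close>

definition newton_coeff :: "nat \<Rightarrow> monom \<Rightarrow> cpoly \<Rightarrow> complex"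
  where "newton_coeff n b0 p =
    (\<Sum>b\<in>parity_class n b0. newton_wt n (half b0) b * (mfact n b * Poly_Mapping.lookup p b))"

lemma lookup_newton_poly:
  "Poly_Mapping.lookup (newton_poly n b0) b =
      (if b \<in> parity_class n b0 then newton_val n (half b0) b / mfact n b else 0)"
  unfolding newton_poly_def by (rule lookup_sum_single[OF finite_parity_class])

lemma newton_poly_in_I:
  assumes b0: "b0 \<in> mons n (j + d)" and low: "(\<Sum>k=1..n. half b0 k) \<le> j"
  shows "newton_poly n b0 \<in> I_ideal n d"
proof -
  obtain q where q: "exponent_poly n (\<Sum>k=1..n. half b0 k) q"
    and q_eq: "\<And>b. b \<in> parity_class n b0 \<Longrightarrow> q b = newton_val n (half b0) b"
    using newton_val_exponent_poly by blast
  let ?w = "\<lambda>\<epsilon>. const (sign_val n \<epsilon> b0 / 2 ^ n) * weighted n (j + d) \<epsilon> q"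
  have "falling n 0 b = 1" for b by (simp add: falling_def)
  then have "weighted n (j + d) \<epsilon> q \<in> I_ideal n d" if "\<epsilon> \<in> signs n" for \<epsilon>
    using weighted_in_I[OF that q, of 0 j d] low by (simp add: mdeg_def)
  then have "(\<Sum>\<epsilon>\<in>signs n. ?w \<epsilon>) \<in> I_ideal n d"
    by (intro I_sum I_mult const_closed)
  also have "(\<Sum>\<epsilon>\<in>signs n. ?w \<epsilon>) = newton_poly n b0"
  proof (rule poly_mapping_eqI)
    fix b
    show "Poly_Mapping.lookup (\<Sum>\<epsilon>\<in>signs n. ?w \<epsilon>) b = Poly_Mapping.lookup (newton_poly n b0) b"
    proof (cases "b \<in> mons n (j + d)")
      case True
      have "Poly_Mapping.lookup (\<Sum>\<epsilon>\<in>signs n. ?w \<epsilon>) b =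
          (\<Sum>\<epsilon>\<in>signs n. sign_val n \<epsilon> b0 * sign_val n \<epsilon> b) * (q b / mfact n b / 2 ^ n)"
        using True by (simp add: lookup_sum lookup_const_mult lookup_weighted sum_distrib_right)
          (simp add: sum_divide_distrib mult_ac)
      also have "\<dots> = Poly_Mapping.lookup (newton_poly n b0) b"
        unfolding sum_signs[OF b0 True] by (simp add: lookup_newton_poly q_eq)
      finally show ?thesis .
    next
      case False
      then have "b \<notin> parity_class n b0" using parity_class_subset[of n b0] b0 by (auto simp: mons_def)
      with False show ?thesis by (simp add: lookup_sum lookup_const_mult lookup_weighted
          lookup_newton_poly)
    qed
  qed
  finally show ?thesis .
qed

text \<open>
  This is the transpose of the product rule \<open>\<Delta>\<^sup>a(x q)(0) = a (\<Delta>\<^sup>a q(0) + \<Delta>\<^sup>a\<^sup>-\<^sup>1 q(0))\<close>.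
\<close>

lemma newton_wt_half:
  assumes k: "k \<in> {1..n}"
  shows "of_nat (half b k) * newton_wt n \<alpha> b =
    of_nat (\<alpha> k) * (newton_wt n \<alpha> b + newton_wt n (\<alpha>(k := \<alpha> k - 1)) b)"
proof -
  let ?w = "\<lambda>a x. (- 1) ^ (a + x) * (of_nat (a choose x) :: complex)"
  have one_dim: "of_nat x * ?w a x = of_nat a * (?w a x + ?w (a - 1) x)" for a x
  proof (cases a)
    case 0
    then show ?thesis by (cases x) auto
  next
    case (Suc m)
    show ?thesis
    proof (cases x)
      case (Suc y)
      have "of_nat (Suc y) * (of_nat (Suc m choose Suc y) :: complex) =
          of_nat (Suc m) * of_nat (m choose y)"
        using Suc_times_binomial_eq[of m y] by (simp only: flip: of_nat_mult) (simp add: mult.commute)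
      then have "of_nat (Suc y) * ((- 1) ^ (Suc m + Suc y) * (of_nat (Suc m choose Suc y) :: complex)) =
          (- 1) ^ (Suc m + Suc y) * (of_nat (Suc m) * of_nat (m choose y))"
        by (metis mult.left_commute)
      also have "\<dots> = of_nat (Suc m) * (?w (Suc m) (Suc y) + ?w m (Suc y))"
        by (simp add: algebra_simps)
      finally show ?thesis using Suc \<open>a = Suc m\<close> by simp
    qed (simp add: \<open>a = Suc m\<close>)
  qed
  have split: "newton_wt n \<beta> b = ?w (\<beta> k) (half b k) * (\<Prod>l\<in>{1..n} - {k}. ?w (\<beta> l) (half b l))" for \<beta>
    unfolding newton_wt_def by (rule prod.remove) (use k in auto)
  have "(\<Prod>l\<in>{1..n} - {k}. ?w ((\<alpha>(k := \<alpha> k - 1)) l) (half b l)) = (\<Prod>l\<in>{1..n} - {k}. ?w (\<alpha> l) (half b l))"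
    by (intro prod.cong) auto
  then have split': "newton_wt n (\<alpha>(k := \<alpha> k - 1)) b =
      ?w (\<alpha> k - 1) (half b k) * (\<Prod>l\<in>{1..n} - {k}. ?w (\<alpha> l) (half b l))"
    unfolding split by simp
  show ?thesis
    unfolding split[of \<alpha>] split'
    using arg_cong[OF one_dim[of "half b k" "\<alpha> k"],
        of "\<lambda>z. z * (\<Prod>l\<in>{1..n} - {k}. ?w (\<alpha> l) (half b l))"]
    by (simp only: distrib_right mult.assoc)
qed

text \<open>
  A polynomial function of degree \<open>r\<close> has no Newton coefficients of degree above \<open>r\<close>.
\<close>

lemma newton_wt_exponent_poly:
  assumes "exponent_poly n r q"
    and "(\<Sum>k=1..n. \<alpha> k) \<le> (\<Sum>k\<le>n. half b0 k)" "r < (\<Sum>k=1..n. \<alpha> k)"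
  shows "(\<Sum>b\<in>parity_class n b0. newton_wt n \<alpha> b * q b) = 0"
  using assms
proof (induction arbitrary: \<alpha> rule: exponent_poly.induct)
  case (one r)
  have "newton_val n (\<lambda>_. 0) b = 1" for b by (simp add: newton_val_def)
  then show ?case
    using newton_orthogonal[OF one(1), of "\<lambda>_. 0"] one(2) by (auto split: if_splits)
next
  case (mult r q k)
  let ?N = "\<lambda>q. \<Sum>b\<in>parity_class n b0. newton_wt n \<alpha> b * q b"
  let ?x = "\<lambda>k b. of_nat (Poly_Mapping.lookup b k) :: complex"
  have q0: "?N q = 0" using mult.IH[OF mult.prems(1)] mult.prems(2) by simp
  have pos: "?N (\<lambda>b. ?x k b * q b) = 0" if k: "k \<in> {1..n}" for k
  proof -
    define \<alpha>' where "\<alpha>' = \<alpha>(k := \<alpha> k - 1)"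
    let ?h = "of_nat (Poly_Mapping.lookup b0 k mod 2) :: complex"
    have "newton_wt n \<alpha> b * (?x k b * q b) = ?h * (newton_wt n \<alpha> b * q b) +
        2 * of_nat (\<alpha> k) * (newton_wt n \<alpha> b * q b + newton_wt n \<alpha>' b * q b)"
      if b: "b \<in> parity_class n b0" for b
    proof -
      have "Poly_Mapping.lookup b k = Poly_Mapping.lookup b0 k mod 2 + 2 * half b k"
        using b k by (auto simp: parity_class_def half_def mod_2_eq_odd)
      then have "?x k b = ?h + 2 * of_nat (half b k)"
        by (metis of_nat_add of_nat_mult of_nat_numeral)
      then have "newton_wt n \<alpha> b * (?x k b * q b) =
          ?h * (newton_wt n \<alpha> b * q b) + 2 * (of_nat (half b k) * newton_wt n \<alpha> b) * q b"
        by (simp add: algebra_simps)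
      also have "of_nat (half b k) * newton_wt n \<alpha> b =
          of_nat (\<alpha> k) * (newton_wt n \<alpha> b + newton_wt n \<alpha>' b)"
        unfolding \<alpha>'_def by (rule newton_wt_half[OF k])
      finally show ?thesis by (simp add: algebra_simps)
    qed
    then have "?N (\<lambda>b. ?x k b * q b) = ?h * ?N q +
        2 * of_nat (\<alpha> k) * (?N q + (\<Sum>b\<in>parity_class n b0. newton_wt n \<alpha>' b * q b))"
      by (simp add: sum.distrib sum_distrib_left distrib_left)
    moreover have "of_nat (\<alpha> k) * (\<Sum>b\<in>parity_class n b0. newton_wt n \<alpha>' b * q b) = 0"
    proof (cases "\<alpha> k = 0")
      case False
      have "(\<Sum>l=1..n. \<alpha> l) = \<alpha> k + (\<Sum>l\<in>{1..n} - {k}. \<alpha> l)"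
        by (rule sum.remove) (use k in auto)
      moreover have "(\<Sum>l=1..n. \<alpha>' l) = \<alpha>' k + (\<Sum>l\<in>{1..n} - {k}. \<alpha>' l)"
        by (rule sum.remove) (use k in auto)
      moreover have "(\<Sum>l\<in>{1..n} - {k}. \<alpha>' l) = (\<Sum>l\<in>{1..n} - {k}. \<alpha> l)"
        by (intro sum.cong) (auto simp: \<alpha>'_def)
      ultimately have "(\<Sum>l=1..n. \<alpha> l) = Suc (\<Sum>l=1..n. \<alpha>' l)"
        using False by (simp add: \<alpha>'_def)
      then have "(\<Sum>b\<in>parity_class n b0. newton_wt n \<alpha>' b * q b) = 0"
        using mult.prems by (intro mult.IH) auto
      then show ?thesis by simp
    qed simp
    ultimately show ?thesis using q0 by (simp add: mult.assoc)
  qed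
  show ?case
  proof (cases "k = 0")
    case True
    \<comment> \<open>The degree is constant on the class, so the exponent of \<open>x\<^sub>0\<close> is affine in the others.\<close>
    have "?x 0 b = of_nat (mdeg n b0) - (\<Sum>k=1..n. ?x k b)" if "b \<in> parity_class n b0" for b
    proof -
      have "mdeg n b0 = Poly_Mapping.lookup b 0 + (\<Sum>k=1..n. Poly_Mapping.lookup b k)"
        using that by (auto simp: parity_class_def mons_def mdeg_def sum_atMost_split)
      then show ?thesis by simp
    qed
    then have "?N (\<lambda>b. ?x 0 b * q b) =
        (\<Sum>b\<in>parity_class n b0. of_nat (mdeg n b0) * (newton_wt n \<alpha> b * q b) -
          (\<Sum>k=1..n. newton_wt n \<alpha> b * (?x k b * q b)))"
      by (intro sum.cong refl) (simp add: left_diff_distrib right_diff_distrib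
          sum_distrib_left sum_distrib_right mult_ac)
    also have "\<dots> = of_nat (mdeg n b0) * ?N q - (\<Sum>k=1..n. ?N (\<lambda>b. ?x k b * q b))"
      by (simp add: sum_subtractf sum_distrib_left) (rule sum.swap)
    also have "\<dots> = 0" using q0 pos by simp
    finally show ?thesis unfolding True .
  qed (use pos mult.hyps in auto)
next
  case (scale r q c)
  then have "c * (\<Sum>b\<in>parity_class n b0. newton_wt n \<alpha> b * q b) = 0" by simp
  then show ?case by (simp only: sum_distrib_left mult.left_commute)
next
  case (add r q q')
  then show ?case by (simp add: distrib_left sum.distrib)
qed

lemma sign_val_parity_class:
  assumes "\<epsilon> \<in> signs n" "b \<in> parity_class n b0"
  shows "sign_val n \<epsilon> b = sign_val n \<epsilon> b0"
  unfolding sign_val_def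
proof (rule prod.cong[OF refl])
  fix k assume k: "k \<in> {..n}"
  then have "\<epsilon> k = 1 \<or> \<epsilon> k = - 1" using assms(1)
      by (auto simp: signs_def PiE_def Pi_def split: if_splits)
  moreover have "even (Poly_Mapping.lookup b k) \<longleftrightarrow> even (Poly_Mapping.lookup b0 k)"
    using assms(2) k by (auto simp: parity_class_def)
  ultimately show "\<epsilon> k ^ Poly_Mapping.lookup b k = \<epsilon> k ^ Poly_Mapping.lookup b0 k"
    by (auto simp: minus_one_power_iff)
qed

lemma newton_coeff_add: "newton_coeff n b0 (p + q) = newton_coeff n b0 p + newton_coeff n b0 q"
  by (simp add: newton_coeff_def lookup_add distrib_left sum.distrib)

lemma newton_coeff_scale: "newton_coeff n b0 (const c * p) = c * newton_coeff n b0 p"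
  by (simp add: newton_coeff_def lookup_const_mult sum_distrib_left mult.left_commute)

lemma newton_coeff_vanishes_on_I:
  assumes b0: "b0 \<in> mons n (j + d)" and high: "j < (\<Sum>k=1..n. half b0 k)" and p: "p \<in> I_ideal n d"
  shows "newton_coeff n b0 p = 0"
proof (rule functional_vanishes_on_I[OF newton_coeff_add _ p])
  fix a :: monom and c g assume a: "Poly_Mapping.keys a \<subseteq> {..n}" and "g \<in> power_forms n d"
  then obtain \<epsilon> where \<epsilon>: "\<epsilon> \<in> signs n" and g: "g = linear_form n \<epsilon> ^ d"
    unfolding power_forms_eq by blast
  have coeff: "mfact n b * Poly_Mapping.lookup (Poly_Mapping.single a c * g) b =
      (if mdeg n a = j then c * fact d * sign_val n \<epsilon> a * sign_val n \<epsilon> b0 else 0) * falling n a b"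
    if b: "b \<in> parity_class n b0" for b
  proof -
    have "Poly_Mapping.keys b \<subseteq> {..n}" "mdeg n b = j + d"
      using b b0 by (auto simp: parity_class_def mons_def)
    then show ?thesis
      unfolding g by (auto simp: lookup_monom_linear_form_power[OF \<epsilon> a] sign_val_parity_class[OF \<epsilon> b])
  qed
  have "newton_coeff n b0 (Poly_Mapping.single a c * g) =
      (if mdeg n a = j then c * fact d * sign_val n \<epsilon> a * sign_val n \<epsilon> b0 else 0) *
      (\<Sum>b\<in>parity_class n b0. newton_wt n (half b0) b * falling n a b)"
    unfolding newton_coeff_def sum_distrib_left
    by (intro sum.cong refl) (simp only: coeff mult.left_commute)
  moreover have "(\<Sum>b\<in>parity_class n b0. newton_wt n (half b0) b * falling n a b) = 0" if "mdeg n a = j"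
    by (rule newton_wt_exponent_poly[OF exponent_poly_falling]) (use that high in \<open>auto simp: sum_atMost_split\<close>)
  ultimately show "newton_coeff n b0 (Poly_Mapping.single a c * g) = 0" by auto
qed

lemma newton_dual:
  assumes b0: "b0 \<in> mons n i" and b1: "b1 \<in> mons n i"
  shows "newton_coeff n b0 (newton_poly n b1) = (if b0 = b1 then 1 else 0)"
proof (cases "b1 \<in> parity_class n b0")
  case True
  have "newton_coeff n b0 (newton_poly n b1) =
      (\<Sum>b\<in>parity_class n b0. newton_wt n (half b0) b * newton_val n (half b1) b)"
    unfolding newton_coeff_def
    by (intro sum.cong refl) (simp add: lookup_newton_poly parity_class_eq[OF True])
  also have "\<dots> = (if \<forall>k\<in>{1..n}. half b0 k = half b1 k then 1 else 0)"
    by (rule newton_orthogonal) (simp add: sum_atMost_split)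
  also have "(\<forall>k\<in>{1..n}. half b0 k = half b1 k) \<longleftrightarrow> b0 = b1"
    using lift_half[OF parity_class_self[OF b0], of "half b0"] lift_half[OF True, of "half b0"] by auto
  finally show ?thesis .
next
  case False
  have "b \<notin> parity_class n b1" if "b \<in> parity_class n b0" for b
    using that False parity_class_eq parity_class_self[OF b1] by metis
  then have "newton_coeff n b0 (newton_poly n b1) = 0"
    by (simp add: newton_coeff_def lookup_newton_poly)
  then show ?thesis using False parity_class_self[OF b0] by auto
qed

text \<open>
  The forms \<open>newton_poly n c\<close> and the functionals \<open>newton_coeff n c\<close> are dual bases of the span of
  any union of parity classes.
\<close>

lemma newton_expansion:
  assumes B: "B \<subseteq> mons n i" and closed: "\<And>b. b \<in> B \<Longrightarrow> parity_class n b \<subseteq> B"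
    and p: "Poly_Mapping.keys p \<subseteq> B"
  shows "p = (\<Sum>c\<in>B. const (newton_coeff n c p) * newton_poly n c)"
proof (rule poly_mapping_eqI)
  fix b
  let ?l = "Poly_Mapping.lookup"
  have "?l (\<Sum>c\<in>B. const (newton_coeff n c p) * newton_poly n c) b =
      (\<Sum>c\<in>B. newton_coeff n c p * ?l (newton_poly n c) b)"
    by (simp add: lookup_sum lookup_const_mult)
  also have "\<dots> = ?l p b"
  proof (cases "b \<in> B")
    case False
    then have "?l (newton_poly n c) b = 0" if "c \<in> B" for c
      using closed[OF that] by (auto simp: lookup_newton_poly)
    moreover have "?l p b = 0" using False p by (auto simp: in_keys_iff)
    ultimately show ?thesis by simp
  next
    case True
    let ?C = "parity_class n b"
    have bm: "b \<in> mons n i" using B True by blast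
    have C: "b \<in> parity_class n c \<longleftrightarrow> c \<in> ?C" if "c \<in> B" for c
      using that B bm parity_class_sym by blast
    have finB: "finite B" using finite_subset[OF B finite_mons] .
    have "(\<Sum>c\<in>B. newton_coeff n c p * ?l (newton_poly n c) b) =
        (\<Sum>c\<in>?C. newton_coeff n c p * ?l (newton_poly n c) b)"
      by (rule sum.mono_neutral_right[OF finB closed[OF True]]) (auto simp: lookup_newton_poly C)
    also have "\<dots> = (\<Sum>c\<in>?C. \<Sum>b'\<in>?C. (newton_val n (half c) b * newton_wt n (half c) b') *
        (mfact n b' * ?l p b' / mfact n b))"
    proof (rule sum.cong[OF refl])
      fix c assume c: "c \<in> ?C"
      then have "b \<in> parity_class n c" using C closed[OF True] by blast
      then show "newton_coeff n c p * ?l (newton_poly n c) b =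
          (\<Sum>b'\<in>?C. (newton_val n (half c) b * newton_wt n (half c) b') * (mfact n b' *
              ?l p b' / mfact n b))"
        by (simp add: newton_coeff_def lookup_newton_poly parity_class_eq[OF c])
          (simp add: sum_distrib_left sum_divide_distrib mult_ac)
    qed
    also have "\<dots> = (\<Sum>b'\<in>?C. (\<Sum>c\<in>?C. newton_val n (half c) b * newton_wt n (half c) b') *
        (mfact n b' * ?l p b' / mfact n b))"
      by (subst sum.swap) (simp add: sum_distrib_right sum_divide_distrib)
    also have "\<dots> = (\<Sum>b'\<in>?C. if b = b' then mfact n b' * ?l p b' / mfact n b else 0)"
      using parity_class_self[OF bm] by (intro sum.cong refl) (simp add: newton_inversion)
    also have "\<dots> = ?l p b"
      using parity_class_self[OF bm] by (simp add: sum.delta finite_parity_class)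
    finally show ?thesis .
  qed
  finally show "?l p b = ?l (\<Sum>c\<in>B. const (newton_coeff n c p) * newton_poly n c) b" by simp
qed

section \<open>The Hilbert function\<close>

text \<open>
  The span of a set of monomials.
\<close>

definition poly_span :: "monom set \<Rightarrow> cpoly set"
  where "poly_span B = {p. Poly_Mapping.keys p \<subseteq> B}"

lemma poly_span_0: "0 \<in> poly_span B"
  and poly_span_add: "u \<in> poly_span B \<Longrightarrow> v \<in> poly_span B \<Longrightarrow> u + v \<in> poly_span B"
  and poly_span_scale: "u \<in> poly_span B \<Longrightarrow> const c * u \<in> poly_span B"
  using keys_add[of u v] by (auto simp: poly_span_def in_keys_iff lookup_const_mult)

lemma poly_span_carrier: "B \<subseteq> mons n i \<Longrightarrow> poly_span B \<subseteq> carrier (S_ring n)"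
  by (auto simp: poly_span_def mons_def subset_iff)

text \<open>
  The ideal has no nonzero elements of degree less than \<open>d\<close>, so the monomials stay independent.
\<close>

lemma R_dim_low_degree:
  assumes i: "i < d"
  shows "R_dim n d (residue_class n d ` poly_span (mons n i)) = card (mons n i)"
proof (rule R_dim_eq_card[where p = "\<lambda>b. Poly_Mapping.single b 1"
    and f = "\<lambda>b p. Poly_Mapping.lookup p b"])
  show "poly_span (mons n i) \<subseteq> carrier (S_ring n)" by (rule poly_span_carrier[OF order_refl])
  fix b p assume b: "b \<in> mons n i" and p: "p \<in> I_ideal n d"
  show "Poly_Mapping.lookup p b = 0"
  proof (rule functional_vanishes_on_I[OF _ _ p, where f = "\<lambda>p. Poly_Mapping.lookup p b"])
    fix a :: monom and c g assume a: "Poly_Mapping.keys a \<subseteq> {..n}" and "g \<in> power_forms n d"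
    then obtain \<epsilon> where "\<epsilon> \<in> signs n" "g = linear_form n \<epsilon> ^ d"
      unfolding power_forms_eq by blast
    then show "Poly_Mapping.lookup (Poly_Mapping.single a c * g) b = 0"
      using a b i lookup_monom_linear_form_power[of \<epsilon> n a b c d] by (auto simp: mons_def)
  qed (simp add: lookup_add)
next
  fix w assume w: "w \<in> poly_span (mons n i)"
  have "w = (\<Sum>b\<in>mons n i. const (Poly_Mapping.lookup w b) * Poly_Mapping.single b 1)"
  proof (rule poly_mapping_eqI)
    fix b
    have "const c * Poly_Mapping.single b' 1 = Poly_Mapping.single b' c" for c b'
      by (simp add: const_def mult_single)
    then show "Poly_Mapping.lookup w b =
        Poly_Mapping.lookup (\<Sum>b\<in>mons n i. const (Poly_Mapping.lookup w b) * Poly_Mapping.single b 1) b"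
      using w by (auto simp: lookup_sum_single finite_mons poly_span_def in_keys_iff)
  qed
  then show "w - (\<Sum>b\<in>mons n i. const (Poly_Mapping.lookup w b) * Poly_Mapping.single b 1) \<in> I_ideal n d"
    using I_zero by simp
qed (use i in \<open>auto simp: finite_mons poly_span_0 poly_span_scale lookup_add lookup_const_mult
    lookup_single
    intro: poly_span_add\<close>, auto simp: poly_span_def)

text \<open>
  In degree \<open>j + d\<close> the ideal is spanned by the \<open>newton_poly n b\<close> with
  \<open>half b 1 + \<dots> + half b n \<le> j\<close>, so the others form a basis of the quotient.
\<close>

lemma R_dim_parity_classes:
  assumes d: "d > 0" and B: "B \<subseteq> mons n (j + d)" and closed: "\<And>b. b \<in> B \<Longrightarrow> parity_class n b \<subseteq> B"
  shows "R_dim n d (residue_class n d ` poly_span B) = card {b \<in> B. j < (\<Sum>k=1..n. half b k)}"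
proof (rule R_dim_eq_card[where p = "newton_poly n" and f = "newton_coeff n", OF d])
  let ?A = "{b \<in> B. j < (\<Sum>k=1..n. half b k)}"
  have finB: "finite B" using finite_subset[OF B finite_mons] .
  then show "finite ?A" by simp
  show "poly_span B \<subseteq> carrier (S_ring n)" by (rule poly_span_carrier[OF B])
  show "newton_poly n b \<in> poly_span B" if "b \<in> ?A" for b
    using closed[of b] that by (auto simp: poly_span_def in_keys_iff
        lookup_newton_poly split: if_splits)
  show "newton_coeff n b u = 0" if "b \<in> ?A" "u \<in> I_ideal n d" for b u
    using that B by (intro newton_coeff_vanishes_on_I) auto
  show "newton_coeff n a (newton_poly n b) = (if a = b then 1 else 0)" if "a \<in> ?A" "b \<in> ?A" for a b
    using that B newton_dual by blast
  fix w assume w: "w \<in> poly_span B"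
  let ?t = "\<lambda>b. const (newton_coeff n b w) * newton_poly n b"
  have "w = (\<Sum>b\<in>B. ?t b)"
    using newton_expansion[OF B closed] w by (simp add: poly_span_def)
  also have "\<dots> = (\<Sum>b\<in>B - ?A. ?t b) + (\<Sum>b\<in>?A. ?t b)"
    using finB by (intro sum.subset_diff) auto
  finally have "w - (\<Sum>b\<in>?A. ?t b) = (\<Sum>b\<in>B - ?A. ?t b)" unfolding diff_eq_eq .
  also have "\<dots> \<in> I_ideal n d"
    using B by (intro I_sum I_mult const_closed newton_poly_in_I) auto
  finally show "w - (\<Sum>b\<in>?A. ?t b) \<in> I_ideal n d" .
qed (auto simp: poly_span_0 poly_span_scale newton_coeff_add newton_coeff_scale intro: poly_span_add)

lemma card_mons: "card (mons n i) = (n + i) choose n"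
proof -
  have "bij_betw (\<lambda>b. map (Poly_Mapping.lookup b) [0..<Suc n]) (mons n i)
      {l. length l = Suc n \<and> sum_list l = i}"
  proof (rule bij_betw_byWitness[where f' = "\<lambda>l. monom_of n (nth l)"])
    show "\<forall>b\<in>mons n i. monom_of n (nth (map (Poly_Mapping.lookup b) [0..<Suc n])) = b"
      by (auto intro!: monom_of_lookup simp: mons_def less_Suc_eq_le simp del: upt_Suc)
    show "\<forall>l\<in>{l. length l = Suc n \<and> sum_list l = i}.
        map (Poly_Mapping.lookup (monom_of n (nth l))) [0..<Suc n] = l"
      by (auto intro!: nth_equalityI simp: lookup_monom_of simp del: upt_Suc)
    show "(\<lambda>b. map (Poly_Mapping.lookup b) [0..<Suc n]) ` mons n i \<subseteq>
        {l. length l = Suc n \<and> sum_list l = i}"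
      by (auto simp: mons_def mdeg_def interv_sum_list_conv_sum_set_nat atLeast0LessThan lessThan_Suc_atMost simp del: upt_Suc)
    show "(\<lambda>l. monom_of n (nth l)) ` {l. length l = Suc n \<and> sum_list l = i} \<subseteq> mons n i"
      using keys_monom_of
      by (auto simp: mons_def mdeg_monom_of sum_list_sum_nth atLeast0LessThan lessThan_Suc_atMost)
  qed
  then have "card (mons n i) = card {l :: nat list. length l = Suc n \<and> sum_list l = i}"
    by (rule bij_betw_same_card)
  also have "\<dots> = (i + Suc n - 1) choose i" by (rule card_length_sum_list)
  also have "\<dots> = (n + i) choose n"
    using binomial_symmetric[of i "n + i"] by (simp add: add.commute)
  finally show ?thesis .
qed

lemma card_parity_class_low:
  assumes "r \<le> (\<Sum>k\<le>n. half b0 k)"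
  shows "card {b \<in> parity_class n b0. (\<Sum>k=1..n. half b k) \<le> r} = (n + r) choose n"
proof -
  let ?C = "{b \<in> parity_class n b0. (\<Sum>k=1..n. half b k) \<le> r}"
  let ?g = "\<lambda>b. monom_of n (\<lambda>k. if k = 0 then r - (\<Sum>k=1..n. half b k) else half b k)"
  have "bij_betw (\<lambda>c. lift n b0 (Poly_Mapping.lookup c)) (mons n r) ?C"
  proof (rule bij_betw_byWitness[where f' = ?g])
    have le: "(\<Sum>k=1..n. Poly_Mapping.lookup c k) \<le> r"
        "Poly_Mapping.lookup c 0 = r - (\<Sum>k=1..n. Poly_Mapping.lookup c k)"
      if "c \<in> mons n r" for c
    proof -
      have "Poly_Mapping.lookup c 0 + (\<Sum>k=1..n. Poly_Mapping.lookup c k) = r"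
        using that unfolding sum_atMost_split[symmetric] by (simp add: mons_def mdeg_def)
      then show "(\<Sum>k=1..n. Poly_Mapping.lookup c k) \<le> r"
        "Poly_Mapping.lookup c 0 = r - (\<Sum>k=1..n. Poly_Mapping.lookup c k)" by linarith+
    qed
    have half: "(\<Sum>k=1..n. half (lift n b0 g) k) = (\<Sum>k=1..n. g k)" for g
      by (intro sum.cong) (auto simp: half_lift)
    show "\<forall>c\<in>mons n r. ?g (lift n b0 (Poly_Mapping.lookup c)) = c"
    proof
      fix c assume c: "c \<in> mons n r"
      show "?g (lift n b0 (Poly_Mapping.lookup c)) = c"
        unfolding half by (rule monom_of_lookup) (use c le[OF c] in \<open>auto simp: half_lift mons_def\<close>)
    qed
    show "(\<lambda>c. lift n b0 (Poly_Mapping.lookup c)) ` mons n r \<subseteq> ?C"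
    proof
      fix b assume "b \<in> (\<lambda>c. lift n b0 (Poly_Mapping.lookup c)) ` mons n r"
      then obtain c where c: "c \<in> mons n r" "b = lift n b0 (Poly_Mapping.lookup c)" by blast
      then show "b \<in> ?C"
        using lift_in_class[OF order.trans[OF le(1)[OF c(1)] assms]] le(1)[OF c(1)] half by simp
    qed
    show "\<forall>b\<in>?C. lift n b0 (Poly_Mapping.lookup (?g b)) = b"
    proof
      fix b assume "b \<in> ?C"
      then have "b \<in> parity_class n b0" by blast
      then show "lift n b0 (Poly_Mapping.lookup (?g b)) = b"
        by (rule lift_half) (simp add: lookup_monom_of)
    qed
    show "?g ` ?C \<subseteq> mons n r"
    proof
      fix c assume "c \<in> ?g ` ?C"
      then obtain b where b: "b \<in> ?C" "c = ?g b" by blast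
      have "mdeg n c = r" using b(1) unfolding b(2) mdeg_monom_of sum_atMost_split by simp
      then show "c \<in> mons n r" using keys_monom_of b(2) by (auto simp: mons_def)
    qed
  qed
  from bij_betw_same_card[OF this] show ?thesis by (simp only: card_mons)
qed

text \<open>
  The monomials of degree \<open>i\<close> with parity vector \<open>h\<close>.
\<close>

definition parity_mons :: "nat \<Rightarrow> nat \<Rightarrow> (nat \<Rightarrow> bit) \<Rightarrow> monom set"
  where "parity_mons n i h = {b \<in> mons n i. \<forall>k\<le>n. of_nat (Poly_Mapping.lookup b k) = h k}"

lemma S_deg_eq: "S_deg n i = poly_span (mons n i)"
  by (auto simp: S_deg_def poly_span_def mons_def)

lemma S_bideg_eq: "S_bideg n i h = poly_span (parity_mons n i h)"
  by (auto simp: S_bideg_def poly_span_def mons_def parity_mons_def)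

lemma of_nat_bit_eq_iff: "(of_nat x :: bit) = of_nat y \<longleftrightarrow> (even x \<longleftrightarrow> even y)"
  by (simp only: Z2.bit_eq_iff even_of_nat)

lemma parity_mons_eq_class: "b0 \<in> parity_mons n i h \<Longrightarrow> parity_mons n i h = parity_class n b0"
proof -
  assume b0: "b0 \<in> parity_mons n i h"
  have "of_nat (Poly_Mapping.lookup b k) = h k \<longleftrightarrow> (even (Poly_Mapping.lookup b k) \<longleftrightarrow>
      even (Poly_Mapping.lookup b0 k))"
    if "k \<le> n" for b k
  proof -
    have "h k = of_nat (Poly_Mapping.lookup b0 k)" using b0 that by (simp add: parity_mons_def)
    then show ?thesis by (simp only: of_nat_bit_eq_iff)
  qed
  moreover have "mdeg n b0 = i" using b0 by (simp add: parity_mons_def mons_def)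
  ultimately show ?thesis by (simp add: parity_mons_def parity_class_def cong: conj_cong)
qed

lemma parity_mons_mdeg:
  assumes "b \<in> parity_mons n i h"
  shows "i = wt n h + 2 * (\<Sum>k\<le>n. half b k)"
proof -
  have "(\<Sum>k\<le>n. Poly_Mapping.lookup b k mod 2) = wt n h"
    unfolding wt_def
  proof (rule sum.cong[OF refl])
    fix k assume "k \<in> {..n}"
    then have "h k = of_nat (Poly_Mapping.lookup b k)" using assms by (simp add: parity_mons_def)
    then show "Poly_Mapping.lookup b k mod 2 = of_bit (h k)" by (simp only: mod_2_eq_odd even_of_nat)
  qed
  then show ?thesis using assms mdeg_half[of n b] by (simp add: parity_mons_def mons_def)
qed

lemma parity_mons_nonempty:
  assumes "wt n h \<le> i" "even (i - wt n h)"
  shows "\<exists>b. b \<in> parity_mons n i h"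
proof -
  let ?f = "\<lambda>k. of_bit (h k) + (if k = 0 then i - wt n h else 0)"
  have "sum ?f {..n} = wt n h + (i - wt n h)"
    by (simp add: sum.distrib wt_def sum.delta)
  then have "mdeg n (monom_of n ?f) = i" using assms by (simp add: mdeg_monom_of)
  moreover have "(of_nat (?f k) :: bit) = h k" for k
    using assms(2) by (simp only: Z2.bit_eq_iff even_of_nat) auto
  ultimately have "monom_of n ?f \<in> parity_mons n i h"
    by (auto simp: parity_mons_def mons_def lookup_monom_of keys_monom_of[THEN subsetD, simplified]
        simp del: of_nat_add)
  then show ?thesis by blast
qed

lemma R_dim_bideg:
  assumes d: "d > 0"
  shows "R_dim n d (R_bideg n d (j + d) h) =
      card {b \<in> parity_mons n (j + d) h. j < (\<Sum>k=1..n. half b k)}"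
  unfolding R_bideg_def S_bideg_eq
proof (rule R_dim_parity_classes[OF d])
  show "parity_mons n (j + d) h \<subseteq> mons n (j + d)" by (auto simp: parity_mons_def)
qed (use parity_mons_eq_class in blast)

lemma card_bideg:
  assumes h: "h \<in> H_set n d j"
  shows "int (card {b \<in> parity_mons n (j + d) h. j < (\<Sum>k=1..n. half b k)}) =
    int ((n + (j + d - wt n h) div 2) choose n) - int ((n + j) choose n)"
proof -
  obtain b0 where b0: "b0 \<in> parity_mons n (j + d) h"
    using parity_mons_nonempty[of n h "j + d"] h by (auto simp: H_set_def)
  let ?e = "\<Sum>k\<le>n. half b0 k"
  have e: "j + d = wt n h + 2 * ?e" using parity_mons_mdeg[OF b0] .
  then have je: "j \<le> ?e" using h by (auto simp: H_set_def)
  let ?C = "parity_class n b0" and ?s = "\<lambda>b. \<Sum>k=1..n. half b k"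
  have "?s b \<le> ?e" if "b \<in> ?C" for b
    using parity_class_half_sum[OF that] by (simp add: sum_atMost_split)
  then have "?C = {b \<in> ?C. ?s b \<le> ?e}" by auto
  then have "card ?C = (n + ?e) choose n" using card_parity_class_low[of ?e b0 n] by simp
  moreover have "card ?C = card {b \<in> ?C. j < ?s b} + card {b \<in> ?C. ?s b \<le> j}"
    using finite_parity_class[of n b0]
    by (subst card_Un_disjoint[symmetric]) (auto intro!: arg_cong[of _ _ card])
  moreover have "card {b \<in> ?C. ?s b \<le> j} = (n + j) choose n"
    by (rule card_parity_class_low[OF je])
  moreover have "(j + d - wt n h) div 2 = ?e" using e by simp
  ultimately show ?thesis unfolding parity_mons_eq_class[OF b0] by simp
qed

lemma finite_Z2_vecs: "finite (Z2_vecs n)"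
proof -
  have "finite (UNIV :: bit set)"
  proof (rule finite_subset)
    show "(UNIV :: bit set) \<subseteq> {0, 1}"
    proof
      show "x \<in> {0, 1}" for x :: bit by (cases x) simp_all
    qed
  qed simp
  then show ?thesis unfolding Z2_vecs_def by (intro finite_PiE) auto
qed

lemma card_Z2_vecs_wt: "card {h \<in> Z2_vecs n. wt n h = w} = (n + 1) choose w"
proof -
  have wt: "wt n h = card {k. k \<le> n \<and> h k = 1}" for h
  proof -
    have "wt n h = (\<Sum>k\<le>n. if h k = 1 then 1 else 0)"
      unfolding wt_def by (intro sum.cong refl) auto
    also have "\<dots> = card {k. k \<le> n \<and> h k = 1}"
      by (simp add: sum.If_cases Int_def)
    finally show ?thesis .
  qed
  let ?i = "\<lambda>K. restrict (\<lambda>k. if k \<in> K then 1 else 0 :: bit) {..n}"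
  have "bij_betw (\<lambda>h. {k. k \<le> n \<and> h k = 1}) {h \<in> Z2_vecs n. wt n h = w} {K. K \<subseteq> {..n} \<and> card K = w}"
  proof (rule bij_betw_byWitness[where f' = ?i])
    have K: "{k. k \<le> n \<and> ?i K k = 1} = K" if "K \<subseteq> {..n}" for K
      using that by (auto split: if_splits)
    show "\<forall>h\<in>{h \<in> Z2_vecs n. wt n h = w}. ?i {k. k \<le> n \<and> h k = 1} = h"
      by (auto simp: Z2_vecs_def PiE_def extensional_def fun_eq_iff restrict_def)
    show "\<forall>K\<in>{K. K \<subseteq> {..n} \<and> card K = w}. {k. k \<le> n \<and> ?i K k = 1} = K"
      using K by blast
    show "(\<lambda>h. {k. k \<le> n \<and> h k = 1}) ` {h \<in> Z2_vecs n. wt n h = w} \<subseteq> {K. K \<subseteq> {..n} \<and> card K = w}"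
      by (auto simp: wt)
    show "?i ` {K. K \<subseteq> {..n} \<and> card K = w} \<subseteq> {h \<in> Z2_vecs n. wt n h = w}"
    proof
      fix h assume "h \<in> ?i ` {K. K \<subseteq> {..n} \<and> card K = w}"
      then obtain K where "K \<subseteq> {..n}" "card K = w" "h = ?i K" by blast
      then show "h \<in> {h \<in> Z2_vecs n. wt n h = w}" using K by (simp add: wt Z2_vecs_def)
    qed
  qed
  then show ?thesis using n_subsets[of "{..n}" w] by (simp add: bij_betw_same_card)
qed

lemma wt_le: "wt n h \<le> n + 1"
  unfolding wt_def using sum_bounded_above[of "{..n}" "\<lambda>k. of_bit (h k)" "1 :: nat"] by simp

text \<open>
  The monomials that index the basis of \<open>R\<close> in degree \<open>j + d\<close> are sorted by their parity vectors.
  Since twice the sum of the halved exponents of such a monomial exceeds \<open>2 j\<close>, its parity vector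
  has weight less than \<open>d - j\<close>; so only the vectors in \<open>H_set n d j\<close> occur.
\<close>

lemma HF_sum:
  assumes d: "d > 0"
  shows "HF n d (j + d) = (\<Sum>h\<in>H_set n d j. R_dim n d (R_bideg n d (j + d) h))"
proof -
  let ?A = "{b \<in> mons n (j + d). j < (\<Sum>k=1..n. half b k)}"
  let ?h = "\<lambda>b. restrict (\<lambda>k. of_nat (Poly_Mapping.lookup b k) :: bit) {..n}"
  have "HF n d (j + d) = card ?A"
    unfolding HF_def R_deg_def S_deg_eq
    by (rule R_dim_parity_classes[OF d]) (auto simp: parity_class_def mons_def)
  also have "\<dots> = (\<Sum>b\<in>?A. 1)" by simp
  also have "\<dots> = (\<Sum>h\<in>H_set n d j. \<Sum>b\<in>{b \<in> ?A. ?h b = h}. 1)"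
  proof (rule sum.group[symmetric])
    show "finite ?A" by (simp add: finite_mons)
    show "finite (H_set n d j)" unfolding H_set_def using finite_Z2_vecs by simp
    show "?h ` ?A \<subseteq> H_set n d j"
    proof
      fix h assume "h \<in> ?h ` ?A"
      then obtain b where b: "b \<in> ?A" "h = ?h b" by blast
      then have "b \<in> parity_mons n (j + d) h" by (simp add: parity_mons_def)
      from parity_mons_mdeg[OF this] have e: "j + d = wt n h + 2 * (\<Sum>k\<le>n. half b k)" .
      moreover have "j < (\<Sum>k\<le>n. half b k)" using b(1) by (simp add: sum_atMost_split)
      ultimately have "int (wt n h) < int d - int j" "wt n h \<le> j + d" "even (j + d - wt n h)"
        by simp_all
      moreover have "h \<in> Z2_vecs n" by (simp add: b(2) Z2_vecs_def)
      ultimately show "h \<in> H_set n d j" using wt_le by (simp add: H_set_def)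
    qed
  qed
  also have "\<dots> = (\<Sum>h\<in>H_set n d j. R_dim n d (R_bideg n d (j + d) h))"
  proof (rule sum.cong[OF refl])
    fix h assume h: "h \<in> H_set n d j"
    have "?h b = h \<longleftrightarrow> (\<forall>k\<le>n. of_nat (Poly_Mapping.lookup b k) = h k)" for b
      using h by (auto simp: H_set_def Z2_vecs_def PiE_def extensional_def fun_eq_iff)
    then have "{b \<in> ?A. ?h b = h} = {b \<in> parity_mons n (j + d) h. j < (\<Sum>k=1..n. half b k)}"
      by (auto simp: parity_mons_def)
    then show "(\<Sum>b\<in>{b \<in> ?A. ?h b = h}. 1) = R_dim n d (R_bideg n d (j + d) h)"
      by (simp add: R_dim_bideg[OF d])
  qed
  finally show ?thesis .
qed

theorem theorem3p6:
  fixes n d :: nat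
  assumes "n > 0" and "d > 0"
  shows "(\<forall>i<d. HF n d i = (n + i) choose n) \<and>
    (\<forall>i j. i = j + d \<longrightarrow>
       HF n d i = (\<Sum>h\<in>H_set n d j. R_dim n d (R_bideg n d i h)) \<and>
       int (HF n d i) =
         (\<Sum>h \<in> {h. int h < int d - int j \<and> h \<le> i \<and> even (i - h)}.
            int ((n + 1) choose h) *
              (int ((n + (i - h) div 2) choose n) - int ((n + j) choose n))))"
proof (intro conjI allI impI)
  fix i assume "i < d"
  then show "HF n d i = (n + i) choose n"
    by (simp add: HF_def R_deg_def S_deg_eq R_dim_low_degree card_mons)
next
  fix i j assume i: "i = j + d"
  show "HF n d i = (\<Sum>h\<in>H_set n d j. R_dim n d (R_bideg n d i h))"
    unfolding i by (rule HF_sum[OF \<open>d > 0\<close>])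
  let ?T = "{h. int h < int d - int j \<and> h \<le> i \<and> even (i - h)}"
  let ?v = "\<lambda>w. int ((n + (i - w) div 2) choose n) - int ((n + j) choose n)"
  have "int (HF n d i) = (\<Sum>h\<in>H_set n d j. ?v (wt n h))"
    unfolding i HF_sum[OF \<open>d > 0\<close>] of_nat_sum
    by (intro sum.cong refl) (simp only: R_dim_bideg[OF \<open>d > 0\<close>] card_bideg)
  also have "\<dots> = (\<Sum>w\<in>?T. \<Sum>h\<in>{h \<in> H_set n d j. wt n h = w}. ?v (wt n h))"
  proof (rule sum.group[symmetric])
    show "finite (H_set n d j)" unfolding H_set_def using finite_Z2_vecs by simp
    show "finite ?T" by (rule finite_subset[of _ "{..i}"]) auto
  qed (auto simp: H_set_def i)
  also have "\<dots> = (\<Sum>w\<in>?T. int ((n + 1) choose w) * ?v w)"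
  proof (rule sum.cong[OF refl])
    fix w assume w: "w \<in> ?T"
    have "{h \<in> H_set n d j. wt n h = w} = {h \<in> Z2_vecs n. wt n h = w}"
      using w wt_le i by (auto simp: H_set_def)
    then show "(\<Sum>h\<in>{h \<in> H_set n d j. wt n h = w}. ?v (wt n h)) = int ((n + 1) choose w) * ?v w"
      by (simp add: card_Z2_vecs_wt)
  qed
  finally show "int (HF n d i) = (\<Sum>w\<in>?T. int ((n + 1) choose w) * ?v w)" .
qed

end
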